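(* Let $\alpha=(A,(A_i)_{i\in I_\alpha})$ and $\beta=(B,(B_i)_{i\in I_\beta})$ be two coset incidence systems, let $\varphi:B\to\mathrm{Aut}(A)$ be a group homomorphism, and let $\alpha$ be $(\beta,\varphi)$-admissible. Suppose that $A$ and $B$ are flag-transitive on $\alpha$ and $\beta$, respectively. Then: (a) the group $G=A\rtimes_\varphi B$ acts flag-transitively on the twisting $\mathcal T(\alpha,\beta)$; (b) $\mathcal T(\alpha,\beta)$ is a coset geometry; (c) $\mathcal T(\alpha,\beta)$ is a finite coset geometry if and only if $\alpha$ and $\beta$ are both finite coset geometries; (d) $\mathcal T(\alpha,\beta)$ is residually connected if both $\alpha$ and $\beta$ are residually connected; (e) $\mathcal T(\alpha,\beta)$ is firm (resp. thin) if both $\alpha$ and $\beta$ are firm (resp. thin).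
   Context: A coset incidence system $(G,(G_i)_{i\in I})$ consists of a group $G$ and a family of subgroups $G_i\le G$ indexed by a type set $I$. It denotes the incidence system whose elements of type $i$ are the left cosets $gG_i$, $g\in G$ (cosets of different types are regarded as different elements), two elements being incident iff their intersection is non-empty. It is finite if its incidence graph (vertices the elements, edges given by incidence) is finite. Its rank is $|I|$. For $J\subseteq I$, $G_J=\bigcap_{j\in J}G_j$, with $G_\emptyset=G$. A flag is a set of pairwise incident elements; its type is the set of types of its elements; a chamber is a flag of type $I$; the corank of a flag $F$ is $|I|-|F|$. The system is a (coset) geometry if every maximal flag is a chamber. The residue of a flag $F$ is the incidence system of all elements incident to every element of $F$ and not in $F$; for a geometry it has rank $|I|-|F|$. A geometry is residually connected if every residue of rank at least two (including that of the empty flag) has connected incidence graph (so rank 1 geometries are residually connected). It is firm (thin) if every residue of a flag of corank one contains at least (exactly) two elements. $G$ acts by left multiplication; $G$ is flag-transitive if for every $J\subseteq I$ it is transitive on the flags of type $J$. $(\beta,\varphi)$-admissible: (1) the action $\varphi$ of $B$ on $A$ permutes the subgroups $(A_i)_{i\in I_\alpha}$, so $B$ acts on $I_\alpha$ by $i^b=j$ iff $\varphi(b)(A_i)=A_j$; (2) letting $K$ be the set of orbits of $B$ on $I_\alpha$, there is exactly one orbit $L\in K$ with $|L|>1$; (3) for a fixed $F_0\in L$, writing $O_J$ ($J\subseteq I_\beta$) for the orbit of $F_0$ under $B_{I_\beta\setminus J}$, one has $O_M\cap O_N=O_{M\cap N}$ for all $M,N\subseteq I_\beta$. Twisting: for $i\in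 I_\beta$ let $O^i$ be the orbit of $F_0$ under $B_i$. $\mathcal T(\alpha,\beta)=(G,(G_i)_{i\in I})$ with $G=A\rtimes_\varphi B$, $I=I_\beta\sqcup K$, $G_i=A_{L\setminus O^i}\rtimes B_i$ if $i\in I_\beta$, and $G_i=A_i\rtimes B$ if $i\in K$, where for an orbit $i\in K$, $A_i=\bigcap_{j\in i}A_j$.
   Formalization: Part (d) is stated for finite type sets of α and β. The thin half of (e) is stated for finite I_β and under the extra condition that the intersection of all B_i fixes F_0; without it the thin claim fails, already for A = B = C_2 × C_2. *)

theory Defs
  imports "HOL-Algebra.Coset" "HOL-Algebra.Bij"
begin

section \<open>Incidence systems\<close>

text \<open>The relation \<open>incident\<close> is only consulted on pairs of elements.  In the
  systems below it is reflexive and never relates distinct elements of the same type.\<close>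

record ('e, 'i) incidence_system =
  elements :: "'e set"
  types :: "'i set"
  type_of :: "'e \<Rightarrow> 'i"
  incident :: "'e \<Rightarrow> 'e \<Rightarrow> bool"

definition flag :: "('e, 'i) incidence_system \<Rightarrow> 'e set \<Rightarrow> bool" where
  "flag \<Gamma> F \<longleftrightarrow> F \<subseteq> elements \<Gamma> \<and> pairwise (incident \<Gamma>) F"

definition flag_type :: "('e, 'i) incidence_system \<Rightarrow> 'e set \<Rightarrow> 'i set" where
  "flag_type \<Gamma> F = type_of \<Gamma> ` F"

definition chamber :: "('e, 'i) incidence_system \<Rightarrow> 'e set \<Rightarrow> bool" where
  "chamber \<Gamma> F \<longleftrightarrow> flag \<Gamma> F \<and> flag_type \<Gamma> F = types \<Gamma>"

definition maximal_flag :: "('e, 'i) incidence_system \<Rightarrow> 'e set \<Rightarrow> bool" where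
  "maximal_flag \<Gamma> F \<longleftrightarrow> flag \<Gamma> F \<and> (\<forall>F'. flag \<Gamma> F' \<and> F \<subseteq> F' \<longrightarrow> F' = F)"

definition geometry :: "('e, 'i) incidence_system \<Rightarrow> bool" where
  "geometry \<Gamma> \<longleftrightarrow> (\<forall>F. maximal_flag \<Gamma> F \<longrightarrow> chamber \<Gamma> F)"

text \<open>Distinct members of a flag have distinct types, so the type set of the residue of
  \<open>F\<close> has \<open>|I| - |F|\<close> members when the rank \<open>|I|\<close> is finite; taking the difference of
  type sets also makes sense for infinite \<open>I\<close>.\<close>

definition residue :: "('e, 'i) incidence_system \<Rightarrow> 'e set \<Rightarrow> ('e, 'i) incidence_system" where
  "residue \<Gamma> F =
    \<lparr> elements = {x \<in> elements \<Gamma> - F. \<forall>y\<in>F. incident \<Gamma> x y},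
      types = types \<Gamma> - flag_type \<Gamma> F,
      type_of = type_of \<Gamma>,
      incident = incident \<Gamma> \<rparr>"

definition incidence_edges :: "('e, 'i) incidence_system \<Rightarrow> ('e \<times> 'e) set" where
  "incidence_edges \<Gamma> =
    {(x, y). x \<in> elements \<Gamma> \<and> y \<in> elements \<Gamma> \<and> x \<noteq> y \<and> incident \<Gamma> x y}"

definition finite_system :: "('e, 'i) incidence_system \<Rightarrow> bool" where
  "finite_system \<Gamma> \<longleftrightarrow> finite (elements \<Gamma>) \<and> finite (incidence_edges \<Gamma>)"

definition connected_system :: "('e, 'i) incidence_system \<Rightarrow> bool" where
  "connected_system \<Gamma> \<longleftrightarrow> elements \<Gamma> \<noteq> {} \<and>
    (\<forall>x\<in>elements \<Gamma>. \<forall>y\<in>elements \<Gamma>. (x, y) \<in> (incidence_edges \<Gamma>)\<^sup>*)"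

definition rank_at_least_two :: "('e, 'i) incidence_system \<Rightarrow> bool" where
  "rank_at_least_two \<Gamma> \<longleftrightarrow> infinite (types \<Gamma>) \<or> card (types \<Gamma>) \<ge> 2"

definition corank_one :: "('e, 'i) incidence_system \<Rightarrow> 'e set \<Rightarrow> bool" where
  "corank_one \<Gamma> F \<longleftrightarrow> card (types \<Gamma> - flag_type \<Gamma> F) = 1"

definition residually_connected :: "('e, 'i) incidence_system \<Rightarrow> bool" where
  "residually_connected \<Gamma> \<longleftrightarrow> geometry \<Gamma> \<and>
    (\<forall>F. flag \<Gamma> F \<and> rank_at_least_two (residue \<Gamma> F) \<longrightarrow> connected_system (residue \<Gamma> F))"

definition firm :: "('e, 'i) incidence_system \<Rightarrow> bool" where
  "firm \<Gamma> \<longleftrightarrow> geometry \<Gamma> \<and>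
    (\<forall>F. flag \<Gamma> F \<and> corank_one \<Gamma> F \<longrightarrow>
      infinite (elements (residue \<Gamma> F)) \<or> card (elements (residue \<Gamma> F)) \<ge> 2)"

definition thin :: "('e, 'i) incidence_system \<Rightarrow> bool" where
  "thin \<Gamma> \<longleftrightarrow> geometry \<Gamma> \<and>
    (\<forall>F. flag \<Gamma> F \<and> corank_one \<Gamma> F \<longrightarrow> card (elements (residue \<Gamma> F)) = 2)"


section \<open>Coset incidence systems\<close>

record ('g, 'i) coset_system =
  Grp :: "'g monoid"
  Types :: "'i set"
  Sub :: "'i \<Rightarrow> 'g set"

definition coset_incidence_system :: "('g, 'i) coset_system \<Rightarrow> bool" where
  "coset_incidence_system \<alpha> \<longleftrightarrow>
    group (Grp \<alpha>) \<and> (\<forall>i\<in>Types \<alpha>. subgroup (Sub \<alpha> i) (Grp \<alpha>))"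

text \<open>A coset of type \<open>i\<close> is tagged with \<open>i\<close>, so that cosets of different types are
  different elements even if they coincide as sets.\<close>

definition system_of :: "('g, 'i) coset_system \<Rightarrow> ('i \<times> 'g set, 'i) incidence_system" where
  "system_of \<alpha> =
    \<lparr> elements = {(i, g <#\<^bsub>Grp \<alpha>\<^esub> Sub \<alpha> i) | i g. i \<in> Types \<alpha> \<and> g \<in> carrier (Grp \<alpha>)},
      types = Types \<alpha>,
      type_of = fst,
      incident = (\<lambda>x y. snd x \<inter> snd y \<noteq> {}) \<rparr>"

text \<open>\<open>parabolic \<alpha> J\<close> is \<open>G\<^sub>J\<close>; intersecting with the carrier only matters for \<open>J = {}\<close>.\<close>

definition parabolic :: "('g, 'i) coset_system \<Rightarrow> 'i set \<Rightarrow> 'g set" where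
  "parabolic \<alpha> J = carrier (Grp \<alpha>) \<inter> (\<Inter>j\<in>J. Sub \<alpha> j)"

definition translate :: "('g, 'i) coset_system \<Rightarrow> 'g \<Rightarrow> 'i \<times> 'g set \<Rightarrow> 'i \<times> 'g set" where
  "translate \<alpha> g x = (fst x, g <#\<^bsub>Grp \<alpha>\<^esub> snd x)"

definition flag_transitive :: "('g, 'i) coset_system \<Rightarrow> bool" where
  "flag_transitive \<alpha> \<longleftrightarrow>
    (\<forall>J\<subseteq>Types \<alpha>. \<forall>F F'.
      flag (system_of \<alpha>) F \<and> flag_type (system_of \<alpha>) F = J \<and>
      flag (system_of \<alpha>) F' \<and> flag_type (system_of \<alpha>) F' = J \<longrightarrow>
      (\<exists>g\<in>carrier (Grp \<alpha>). translate \<alpha> g ` F = F'))"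

definition coset_geometry :: "('g, 'i) coset_system \<Rightarrow> bool" where
  "coset_geometry \<alpha> \<longleftrightarrow> coset_incidence_system \<alpha> \<and> geometry (system_of \<alpha>)"

definition finite_coset_geometry :: "('g, 'i) coset_system \<Rightarrow> bool" where
  "finite_coset_geometry \<alpha> \<longleftrightarrow> coset_geometry \<alpha> \<and> finite_system (system_of \<alpha>)"


section \<open>Semidirect products\<close>

definition semidirect ::
  "'a monoid \<Rightarrow> 'b monoid \<Rightarrow> ('b \<Rightarrow> 'a \<Rightarrow> 'a) \<Rightarrow> ('a \<times> 'b) monoid" where
  "semidirect A B \<phi> =
    \<lparr> carrier = carrier A \<times> carrier B,
      mult = (\<lambda>(a, b) (a', b'). (a \<otimes>\<^bsub>A\<^esub> \<phi> b a', b \<otimes>\<^bsub>B\<^esub> b')),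
      one = (\<one>\<^bsub>A\<^esub>, \<one>\<^bsub>B\<^esub>) \<rparr>"


section \<open>Admissibility and twisting\<close>

text \<open>The set of all \<open>i\<^sup>b\<close> with \<open>b \<in> S\<close>, where \<open>i\<^sup>b = j\<close> iff \<open>\<phi>(b)\<close> maps \<open>A\<^sub>i\<close> onto \<open>A\<^sub>j\<close>.\<close>

definition type_orbit ::
  "('a, 'i) coset_system \<Rightarrow> ('b \<Rightarrow> 'a \<Rightarrow> 'a) \<Rightarrow> 'b set \<Rightarrow> 'i \<Rightarrow> 'i set" where
  "type_orbit \<alpha> \<phi> S i = {j \<in> Types \<alpha>. \<exists>b\<in>S. \<phi> b ` Sub \<alpha> i = Sub \<alpha> j}"

definition type_orbits ::
  "('a, 'i) coset_system \<Rightarrow> ('b, 'j) coset_system \<Rightarrow> ('b \<Rightarrow> 'a \<Rightarrow> 'a) \<Rightarrow> 'i set set" where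
  "type_orbits \<alpha> \<beta> \<phi> = type_orbit \<alpha> \<phi> (carrier (Grp \<beta>)) ` Types \<alpha>"

text \<open>The orbit \<open>O\<^sub>J\<close> of \<open>F0\<close> under the parabolic subgroup of type \<open>I\<^sub>\<beta> - J\<close>.  Note that
  \<open>O\<^sub>J\<close> for \<open>J = {}\<close> is the orbit under the intersection of all the subgroups of \<open>\<beta>\<close>, which can be
  larger than \<open>{F0}\<close>: that intersection may be non-trivial, even if \<open>\<beta>\<close> is thin.\<close>

definition parabolic_orbit ::
  "('a, 'i) coset_system \<Rightarrow> ('b, 'j) coset_system \<Rightarrow> ('b \<Rightarrow> 'a \<Rightarrow> 'a) \<Rightarrow> 'i \<Rightarrow> 'j set \<Rightarrow> 'i set" where
  "parabolic_orbit \<alpha> \<beta> \<phi> F0 J = type_orbit \<alpha> \<phi> (parabolic \<beta> (Types \<beta> - J)) F0"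

text \<open>The uniqueness of \<open>j\<close> in the first clause is what makes \<open>i\<^sup>b\<close> well-defined; for
  \<open>b = 1\<close> it says that the subgroups \<open>A\<^sub>i\<close> are pairwise distinct.  \<open>L\<close> is determined as the
  only orbit with more than one (possibly infinitely many) members, and \<open>F0\<close> is the base
  point chosen in it.\<close>

definition admissible ::
  "('a, 'i) coset_system \<Rightarrow> ('b, 'j) coset_system \<Rightarrow> ('b \<Rightarrow> 'a \<Rightarrow> 'a) \<Rightarrow> 'i set \<Rightarrow> 'i \<Rightarrow> bool" where
  "admissible \<alpha> \<beta> \<phi> L F0 \<longleftrightarrow>
    (\<forall>b\<in>carrier (Grp \<beta>). \<forall>i\<in>Types \<alpha>. \<exists>!j. j \<in> Types \<alpha> \<and> \<phi> b ` Sub \<alpha> i = Sub \<alpha> j) \<and>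
    L \<in> type_orbits \<alpha> \<beta> \<phi> \<and>
    (\<forall>k\<in>type_orbits \<alpha> \<beta> \<phi>. (infinite k \<or> card k > 1) \<longleftrightarrow> k = L) \<and>
    F0 \<in> L \<and>
    (\<forall>M\<subseteq>Types \<beta>. \<forall>N\<subseteq>Types \<beta>.
      parabolic_orbit \<alpha> \<beta> \<phi> F0 M \<inter> parabolic_orbit \<alpha> \<beta> \<phi> F0 N =
      parabolic_orbit \<alpha> \<beta> \<phi> F0 (M \<inter> N))"

text \<open>In the semidirect product the subgroup \<open>X \<times>\<^sub>\<phi> Y\<close> has carrier set \<open>X \<times> Y\<close>.\<close>

definition twisting ::
  "('a, 'i) coset_system \<Rightarrow> ('b, 'j) coset_system \<Rightarrow> ('b \<Rightarrow> 'a \<Rightarrow> 'a) \<Rightarrow> 'i set \<Rightarrow> 'i \<Rightarrow>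
    ('a \<times> 'b, 'j + 'i set) coset_system" where
  "twisting \<alpha> \<beta> \<phi> L F0 =
    \<lparr> Grp = semidirect (Grp \<alpha>) (Grp \<beta>) \<phi>,
      Types = Types \<beta> <+> type_orbits \<alpha> \<beta> \<phi>,
      Sub = (\<lambda>t. case t of
          Inl i \<Rightarrow> parabolic \<alpha> (L - type_orbit \<alpha> \<phi> (Sub \<beta> i) F0) \<times> Sub \<beta> i
        | Inr k \<Rightarrow> parabolic \<alpha> k \<times> carrier (Grp \<beta>)) \<rparr>"

end

theory Submission
  imports Defs
begin

text \<open>
  A coset incidence system is flag-transitive iff every flag has a common group element, that is,
  iff its cosets have the Helly property.  This property passes from the cosets of the \<open>G\<^sub>i\<close> to the
  cosets of all parabolic subgroups, and every element of the twisting is a product of a coset of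
  a parabolic subgroup of \<open>A\<close> with one of \<open>B\<close>; so the twisting has the Helly property as well.

  For a flag-transitive system, firmness, thinness and residual connectedness become statements
  about parabolic subgroups: \<open>G\<^bsub>I - {i}\<^esub>\<close> is not contained in \<open>G\<^sub>i\<close>; \<open>G\<^sub>I\<close> has index 2 in
  \<open>G\<^bsub>I - {i}\<^esub>\<close>; and \<open>G\<^sub>J\<close> is generated by the \<open>G\<^bsub>J \<union> {i}\<^esub>\<close> with \<open>i \<notin> J\<close> whenever \<open>J\<close> has corank at
  least two.  For finite \<open>I\<close> the last one amounts to \<open>G\<^bsub>X \<inter> Y\<^esub> = \<langle>G\<^sub>X, G\<^sub>Y\<rangle>\<close> for all \<open>X\<close> and \<open>Y\<close>.  As the parabolic subgroups of the twisting are
  products, these statements can be checked in each factor, where conjugation by the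
  \<open>B\<close>-factor moves the types in \<open>L\<close>.
\<close>

section \<open>Coset incidence systems and their parabolic subgroups\<close>

lemma system_of_simps [simp]:
  "types (system_of \<alpha>) = Types \<alpha>" "type_of (system_of \<alpha>) = fst"
  "incident (system_of \<alpha>) x y \<longleftrightarrow> snd x \<inter> snd y \<noteq> {}"
  by (simp_all add: system_of_def)

lemma residue_simps [simp]:
  "types (residue \<Gamma> F) = types \<Gamma> - flag_type \<Gamma> F" "incident (residue \<Gamma> F) = incident \<Gamma>"
  by (simp_all add: residue_def)

lemma thin_imp_firm: "thin \<Gamma> \<Longrightarrow> firm \<Gamma>"
  by (auto simp: thin_def firm_def)

lemma parabolic_UN: "parabolic \<alpha> (\<Union>t\<in>T. X t) = carrier (Grp \<alpha>) \<inter> (\<Inter>t\<in>T. parabolic \<alpha> (X t))"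
  by (auto simp: parabolic_def)

lemma parabolic_antimono: "X \<subseteq> Y \<Longrightarrow> parabolic \<alpha> Y \<subseteq> parabolic \<alpha> X"
  by (auto simp: parabolic_def)

text \<open>A normal form for flags: by \<open>flagE\<close>, flag-transitivity puts every flag into
  this form, and any group element common to its cosets can serve as \<open>g\<close>.\<close>

definition flag_at :: "('g, 'i) coset_system \<Rightarrow> 'i set \<Rightarrow> 'g \<Rightarrow> ('i \<times> 'g set) set" where
  "flag_at \<alpha> J g = (\<lambda>j. (j, g <#\<^bsub>Grp \<alpha>\<^esub> Sub \<alpha> j)) ` J"

text \<open>The group is a parameter of its own, so that the notation and lemmas for groups apply to
  \<open>G\<close> directly. The locale is used for the two given systems and again for the
  twisting.\<close>

locale coset_incidence = group G for G (structure) +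
  fixes \<alpha> :: "('g, 'i) coset_system"
  assumes Grp_eq [simp]: "Grp \<alpha> = G"
    and subgroup_Sub: "i \<in> Types \<alpha> \<Longrightarrow> subgroup (Sub \<alpha> i) G"
begin

lemma coset_incidence_system: "coset_incidence_system \<alpha>"
  by (simp add: coset_incidence_system_def subgroup_Sub is_group)

lemma subgroup_parabolic:
  assumes "J \<subseteq> Types \<alpha>" shows "subgroup (parabolic \<alpha> J) G"
proof -
  \<comment> \<open>Inserting the carrier keeps the family nonempty when \<open>J\<close> is empty,
    as \<open>subgroups_Inter\<close> requires.\<close>
  have "parabolic \<alpha> J = \<Inter>(insert (carrier G) (Sub \<alpha> ` J))"
    by (simp add: parabolic_def)
  also have "subgroup \<dots> G"
    using assms by (intro subgroups_Inter) (auto intro: subgroup_Sub subgroup_self)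
  finally show ?thesis .
qed

lemma parabolic_single:
  assumes "i \<in> Types \<alpha>" shows "parabolic \<alpha> {i} = Sub \<alpha> i"
  using subgroup.subset[OF subgroup_Sub[OF assms]] by (auto simp: parabolic_def)

lemma mem_l_coset_iff:
  assumes "subgroup H G" "g \<in> carrier G"
  shows "x \<in> g <# H \<longleftrightarrow> x \<in> carrier G \<and> inv g \<otimes> x \<in> H"
proof
  assume "x \<in> g <# H"
  then obtain h where "h \<in> H" "x = g \<otimes> h" by (auto simp: l_coset_def)
  moreover have "h \<in> carrier G" using \<open>h \<in> H\<close> assms(1) subgroup.mem_carrier by metis
  ultimately show "x \<in> carrier G \<and> inv g \<otimes> x \<in> H"
    using assms by (simp add: m_assoc[symmetric])
next
  assume x: "x \<in> carrier G \<and> inv g \<otimes> x \<in> H"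
  then have "x = g \<otimes> (inv g \<otimes> x)" using assms by (simp add: m_assoc[symmetric])
  then show "x \<in> g <# H" using x by (auto simp: l_coset_def)
qed

lemma l_coset_mem_eq:
  assumes "subgroup H G" "g \<in> carrier G" "x \<in> g <# H" shows "g <# H = x <# H"
  using assms l_repr_independence by blast

lemma l_coset_eq_iff:
  assumes "subgroup H G" "g \<in> carrier G" "h \<in> carrier G"
  shows "g <# H = h <# H \<longleftrightarrow> inv g \<otimes> h \<in> H"
proof
  assume "g <# H = h <# H"
  moreover have "h \<in> h <# H" using assms by (simp add: mem_l_coset_iff subgroup.one_closed)
  ultimately show "inv g \<otimes> h \<in> H" using assms mem_l_coset_iff by blast
next
  assume "inv g \<otimes> h \<in> H"
  then have "h \<in> g <# H" using assms by (simp add: mem_l_coset_iff)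
  then show "g <# H = h <# H" using assms l_coset_mem_eq by blast
qed

lemma self_mem_l_coset: "subgroup H G \<Longrightarrow> g \<in> carrier G \<Longrightarrow> g \<in> g <# H"
  by (simp add: mem_l_coset_iff subgroup.one_closed)

section \<open>Elements and flags through a common group element\<close>

lemma elements_iff:
  "x \<in> elements (system_of \<alpha>) \<longleftrightarrow> (\<exists>i\<in>Types \<alpha>. \<exists>g\<in>carrier G. x = (i, g <# Sub \<alpha> i))"
  by (auto simp: system_of_def)

text \<open>A left coset is represented by each of its members, so an element common to several
  cosets represents all of them at once.\<close>

lemma element_at:
  assumes "x \<in> elements (system_of \<alpha>)" "g \<in> snd x"
  shows "g \<in> carrier G" "fst x \<in> Types \<alpha>" "snd x = g <# Sub \<alpha> (fst x)"
proof -
  obtain i h where x: "i \<in> Types \<alpha>" "h \<in> carrier G" "x = (i, h <# Sub \<alpha> i)"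
    using assms(1) by (auto simp: elements_iff)
  note H = subgroup_Sub[OF x(1)]
  show "g \<in> carrier G" using assms x mem_l_coset_iff[OF H] by auto
  show "fst x \<in> Types \<alpha>" using x by simp
  show "snd x = g <# Sub \<alpha> (fst x)" using x assms l_coset_mem_eq[OF H x(2)] by auto
qed

lemma mem_flag_at:
  assumes "J \<subseteq> Types \<alpha>" "g \<in> carrier G" "x \<in> flag_at \<alpha> J g"
  shows "x \<in> elements (system_of \<alpha>)" "g \<in> snd x"
  using assms by (auto simp: flag_at_def elements_iff intro!: self_mem_l_coset subgroup_Sub)

lemma flag_flag_at:
  assumes "J \<subseteq> Types \<alpha>" "g \<in> carrier G" shows "flag (system_of \<alpha>) (flag_at \<alpha> J g)"
  using mem_flag_at[OF assms] unfolding flag_def pairwise_def system_of_simps by blast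

lemma flag_type_flag_at [simp]: "flag_type (system_of \<alpha>) (flag_at \<alpha> J g) = J"
  by (force simp: flag_type_def flag_at_def)

lemma flag_eq_flag_at:
  assumes "flag (system_of \<alpha>) F" "\<forall>x\<in>F. g \<in> snd x"
  shows "F = flag_at \<alpha> (flag_type (system_of \<alpha>) F) g"
proof -
  have "snd x = g <# Sub \<alpha> (fst x)" if "x \<in> F" for x
    using that assms by (intro element_at(3)) (auto simp: flag_def)
  then have "(\<lambda>x. (fst x, g <# Sub \<alpha> (fst x))) ` F = (\<lambda>x. x) ` F"
    by (intro image_cong) (auto simp: prod_eq_iff)
  then show ?thesis by (simp add: flag_at_def flag_type_def image_image)
qed

lemma flag_type_subset: "flag (system_of \<alpha>) F \<Longrightarrow> flag_type (system_of \<alpha>) F \<subseteq> Types \<alpha>"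
  by (auto simp: flag_def flag_type_def elements_iff subset_iff)

lemma translate_flag_at:
  assumes "J \<subseteq> Types \<alpha>" "g \<in> carrier G" "h \<in> carrier G"
  shows "translate \<alpha> h ` flag_at \<alpha> J g = flag_at \<alpha> J (h \<otimes> g)"
proof -
  have "h <# (g <# Sub \<alpha> j) = (h \<otimes> g) <# Sub \<alpha> j" if "j \<in> J" for j
    using that assms subgroup.subset[OF subgroup_Sub] by (intro lcos_m_assoc) auto
  then show ?thesis by (simp add: flag_at_def translate_def image_image)
qed

text \<open>A flag of each type \<open>J\<close> passes through the identity; moving it onto
  \<open>F\<close> by \<open>g\<close> puts \<open>g\<close> into every coset of \<open>F\<close>.
  Conversely, if \<open>g\<close> and \<open>h\<close> are common to two flags of the same type,
  then \<open>h \<otimes> inv g\<close> carries the first to the second.\<close>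

lemma flag_transitive_iff:
  "flag_transitive \<alpha> \<longleftrightarrow> (\<forall>F. flag (system_of \<alpha>) F \<longrightarrow> (\<exists>g\<in>carrier G. \<forall>x\<in>F. g \<in> snd x))"
proof safe
  fix F assume ft: "flag_transitive \<alpha>" and F: "flag (system_of \<alpha>) F"
  define J where "J = flag_type (system_of \<alpha>) F"
  have J: "J \<subseteq> Types \<alpha>" using F by (simp add: J_def flag_type_subset)
  obtain g where g: "g \<in> carrier G" "translate \<alpha> g ` flag_at \<alpha> J \<one> = F"
    using ft[unfolded flag_transitive_def, rule_format, OF J, of "flag_at \<alpha> J \<one>" F]
      F flag_flag_at[OF J] by (auto simp: J_def)
  then have "F = flag_at \<alpha> J g" using translate_flag_at[OF J one_closed g(1)] by simp
  then show "\<exists>g\<in>carrier G. \<forall>x\<in>F. g \<in> snd x" using mem_flag_at(2)[OF J g(1)] g(1) by blast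
next
  assume *: "\<forall>F. flag (system_of \<alpha>) F \<longrightarrow> (\<exists>g\<in>carrier G. \<forall>x\<in>F. g \<in> snd x)"
  show "flag_transitive \<alpha>" unfolding flag_transitive_def
  proof (intro allI impI, elim conjE)
    fix J F F'
    assume J: "J \<subseteq> Types \<alpha>" and F: "flag (system_of \<alpha>) F" "flag_type (system_of \<alpha>) F = J"
      and F': "flag (system_of \<alpha>) F'" "flag_type (system_of \<alpha>) F' = J"
    obtain g where g: "g \<in> carrier G" "\<forall>x\<in>F. g \<in> snd x" using * F by blast
    obtain h where h: "h \<in> carrier G" "\<forall>x\<in>F'. h \<in> snd x" using * F' by blast
    have "F = flag_at \<alpha> J g" "F' = flag_at \<alpha> J h"
      using flag_eq_flag_at[OF F(1) g(2)] flag_eq_flag_at[OF F'(1) h(2)] F F' by simp_all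
    moreover have "(h \<otimes> inv g) \<otimes> g = h" using g h by (simp add: m_assoc)
    ultimately have "translate \<alpha> (h \<otimes> inv g) ` F = F'"
      using translate_flag_at[OF J g(1), of "h \<otimes> inv g"] g h by simp
    then show "\<exists>g\<in>carrier (Grp \<alpha>). translate \<alpha> g ` F = F'" using g h by auto
  qed
qed

lemma parabolic_subset_carrier: "parabolic \<alpha> J \<subseteq> carrier G"
  by (auto simp: parabolic_def)

lemma Types_eq_fst_elements: "Types \<alpha> = fst ` elements (system_of \<alpha>)"
  by (force simp: elements_iff)

lemma finite_system_iff: "finite_system (system_of \<alpha>) \<longleftrightarrow> finite (elements (system_of \<alpha>))"
  using finite_subset[of "incidence_edges (system_of \<alpha>)" "elements (system_of \<alpha>) \<times> elements (system_of \<alpha>)"]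
  by (auto simp: finite_system_def incidence_edges_def)

lemma parabolic_coset_eq:
  assumes "J \<subseteq> Types \<alpha>" "g \<in> carrier G"
  shows "g <# parabolic \<alpha> J = carrier G \<inter> \<Inter>(snd ` flag_at \<alpha> J g)"
proof -
  have "x \<in> g <# parabolic \<alpha> J \<longleftrightarrow> x \<in> carrier G \<inter> \<Inter>(snd ` flag_at \<alpha> J g)" for x
  proof -
    have "x \<in> g <# parabolic \<alpha> J \<longleftrightarrow> x \<in> carrier G \<and> inv g \<otimes> x \<in> parabolic \<alpha> J"
      using assms by (simp add: mem_l_coset_iff subgroup_parabolic)
    also have "\<dots> \<longleftrightarrow> x \<in> carrier G \<and> (\<forall>j\<in>J. inv g \<otimes> x \<in> Sub \<alpha> j)"
      using assms by (auto simp: parabolic_def)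
    also have "\<dots> \<longleftrightarrow> x \<in> carrier G \<and> (\<forall>j\<in>J. x \<in> g <# Sub \<alpha> j)"
      using assms by (auto simp: mem_l_coset_iff subgroup_Sub subset_iff)
    finally show ?thesis by (simp add: flag_at_def)
  qed
  then show ?thesis by blast
qed

text \<open>By \<open>parabolic_coset_eq\<close> a parabolic coset is cut out by a set of elements,
  and a finite set of elements has finitely many subsets.\<close>

lemma finite_parabolic_cosets:
  assumes "finite (elements (system_of \<alpha>))"
  shows "finite {g <# parabolic \<alpha> J | g J. g \<in> carrier G \<and> J \<subseteq> Types \<alpha>}"
proof (rule finite_subset)
  show "{g <# parabolic \<alpha> J | g J. g \<in> carrier G \<and> J \<subseteq> Types \<alpha>} \<subseteq>
    (\<lambda>E. carrier G \<inter> \<Inter>(snd ` E)) ` Pow (elements (system_of \<alpha>))"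
  proof safe
    fix g J assume *: "g \<in> carrier G" "J \<subseteq> Types \<alpha>"
    then have "flag_at \<alpha> J g \<in> Pow (elements (system_of \<alpha>))" using mem_flag_at(1) by blast
    then show "g <# parabolic \<alpha> J \<in> (\<lambda>E. carrier G \<inter> \<Inter>(snd ` E)) ` Pow (elements (system_of \<alpha>))"
      using parabolic_coset_eq[OF *(2,1)] by (rule rev_image_eqI)
  qed
qed (use assms in simp)

lemma one_mem_parabolic: "J \<subseteq> Types \<alpha> \<Longrightarrow> \<one> \<in> parabolic \<alpha> J"
  using subgroup_parabolic subgroup.one_closed by blast

end

section \<open>Flag-transitive coset geometries\<close>

locale flag_transitive_coset_incidence = coset_incidence +
  assumes flag_transitive: "flag_transitive \<alpha>"
begin

lemma flag_common:
  assumes "flag (system_of \<alpha>) F" shows "\<exists>g\<in>carrier G. \<forall>x\<in>F. g \<in> snd x"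
  using assms flag_transitive flag_transitive_iff by blast

lemma flagE:
  assumes "flag (system_of \<alpha>) F"
  obtains J g where "J \<subseteq> Types \<alpha>" "g \<in> carrier G" "F = flag_at \<alpha> J g"
proof -
  obtain g where "g \<in> carrier G" "\<forall>x\<in>F. g \<in> snd x" using flag_common[OF assms] by blast
  then show thesis using that flag_eq_flag_at[OF assms] flag_type_subset[OF assms] by blast
qed

text \<open>The cosets of the remaining types through the same \<open>g\<close> complete
  \<open>flag_at \<alpha> J g\<close> to a chamber.\<close>

lemma geometry: "geometry (system_of \<alpha>)"
  unfolding geometry_def
proof (intro allI impI)
  fix F assume F: "maximal_flag (system_of \<alpha>) F"
  then obtain J g where J: "J \<subseteq> Types \<alpha>" "g \<in> carrier G" "F = flag_at \<alpha> J g"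
    by (auto simp: maximal_flag_def elim: flagE)
  moreover have "F \<subseteq> flag_at \<alpha> (Types \<alpha>) g" using J by (auto simp: flag_at_def)
  ultimately have "F = flag_at \<alpha> (Types \<alpha>) g"
    using F flag_flag_at[of "Types \<alpha>" g] by (auto simp: maximal_flag_def)
  then show "chamber (system_of \<alpha>) F" using J flag_flag_at[of "Types \<alpha>" g]
    by (simp add: chamber_def)
qed

lemma coset_geometry: "coset_geometry \<alpha>"
  by (simp add: coset_geometry_def coset_incidence_system geometry)

text \<open>A parabolic coset lies inside each coset of its \<open>flag_at\<close>. Hence, if the
  parabolic cosets meet pairwise, all the cosets of these flags together form one flag, and an
  element common to that flag lies in every parabolic coset.\<close>

lemma parabolic_cosets_Helly:
  assumes J: "\<And>t. t \<in> T \<Longrightarrow> J t \<subseteq> Types \<alpha>" and a: "\<And>t. t \<in> T \<Longrightarrow> a t \<in> carrier G"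
    and meet: "\<And>s t. s \<in> T \<Longrightarrow> t \<in> T \<Longrightarrow> (a s <# parabolic \<alpha> (J s)) \<inter> (a t <# parabolic \<alpha> (J t)) \<noteq> {}"
  obtains g where "g \<in> carrier G" "\<And>t. t \<in> T \<Longrightarrow> g \<in> a t <# parabolic \<alpha> (J t)"
proof -
  define F where "F = (\<Union>t\<in>T. flag_at \<alpha> (J t) (a t))"
  have sub: "a t <# parabolic \<alpha> (J t) \<subseteq> snd x" if x: "x \<in> flag_at \<alpha> (J t) (a t)" for t x
  proof
    fix u assume "u \<in> a t <# parabolic \<alpha> (J t)"
    then obtain h where "u = a t \<otimes> h" "\<forall>j\<in>J t. h \<in> Sub \<alpha> j"
      by (auto simp: l_coset_def parabolic_def)
    moreover obtain j where "j \<in> J t" "x = (j, a t <# Sub \<alpha> j)" using x by (auto simp: flag_at_def)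
    ultimately show "u \<in> snd x" by (auto simp: l_coset_def)
  qed
  have "flag (system_of \<alpha>) F"
    unfolding flag_def F_def pairwise_def
  proof (intro conjI ballI impI subsetI; elim UN_E)
    show "x \<in> elements (system_of \<alpha>)" if "t \<in> T" "x \<in> flag_at \<alpha> (J t) (a t)" for x t
      using that J a by (intro mem_flag_at(1)[of "J t" "a t"])
    show "incident (system_of \<alpha>) x y"
      if "t \<in> T" "x \<in> flag_at \<alpha> (J t) (a t)" "s \<in> T" "y \<in> flag_at \<alpha> (J s) (a s)" for x t y s
      using sub[OF that(2)] sub[OF that(4)] meet[OF that(1,3)] by auto
  qed
  then obtain g where g: "g \<in> carrier G" "\<forall>x\<in>F. g \<in> snd x"
    using flag_common by blast
  show thesis
  proof (rule that[OF g(1)])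
    fix t assume t: "t \<in> T"
    have "inv (a t) \<otimes> g \<in> Sub \<alpha> j" if "j \<in> J t" for j
    proof -
      have "g \<in> a t <# Sub \<alpha> j" using g(2)[rule_format, of "(j, a t <# Sub \<alpha> j)"] that t
        by (auto simp: F_def flag_at_def)
      then show ?thesis using that t J a by (auto simp: mem_l_coset_iff subgroup_Sub subset_iff)
    qed
    then show "g \<in> a t <# parabolic \<alpha> (J t)"
      using t J a g(1) by (simp add: mem_l_coset_iff subgroup_parabolic) (auto simp: parabolic_def)
  qed
qed

section \<open>Residues of flags, described inside a parabolic subgroup\<close>

text \<open>Pairwise incident elements of a residue form a flag together with the given one, hence
  share some \<open>u\<close>; the required \<open>h\<close> is \<open>inv g \<otimes> u\<close>. A
  singleton \<open>X\<close> yields the elements of the residue, a pair its edges.\<close>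

lemma common_in_residue:
  assumes J: "J \<subseteq> Types \<alpha>" "g \<in> carrier G"
    and X: "X \<subseteq> elements (residue (system_of \<alpha>) (flag_at \<alpha> J g))" "pairwise (incident (system_of \<alpha>)) X"
  shows "\<exists>h\<in>parabolic \<alpha> J. \<forall>x\<in>X. fst x \<in> Types \<alpha> - J \<and> snd x = (g \<otimes> h) <# Sub \<alpha> (fst x)"
proof -
  let ?F = "flag_at \<alpha> J g"
  have F: "flag (system_of \<alpha>) ?F" by (rule flag_flag_at[OF J])
  have "flag (system_of \<alpha>) (X \<union> ?F)"
    unfolding flag_def
  proof
    show "X \<union> ?F \<subseteq> elements (system_of \<alpha>)"
      using F X by (auto simp: flag_def residue_def)
    have "incident (system_of \<alpha>) x y" "incident (system_of \<alpha>) y x" if "x \<in> X" "y \<in> ?F" for x y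
      using X(1) that by (force simp: residue_def)+
    then show "pairwise (incident (system_of \<alpha>)) (X \<union> ?F)"
      using F X(2) unfolding flag_def pairwise_def by blast
  qed
  then obtain u where u: "u \<in> carrier G" "\<forall>x\<in>X \<union> ?F. u \<in> snd x"
    using flag_common by blast
  have "inv g \<otimes> u \<in> Sub \<alpha> j" if "j \<in> J" for j
  proof -
    have "u \<in> g <# Sub \<alpha> j" using u(2)[rule_format, of "(j, g <# Sub \<alpha> j)"] that by (auto simp: flag_at_def)
    then show ?thesis using that J by (auto simp: mem_l_coset_iff subgroup_Sub subset_iff)
  qed
  then have "inv g \<otimes> u \<in> parabolic \<alpha> J" using J u by (simp add: parabolic_def)
  moreover have "g \<otimes> (inv g \<otimes> u) = u" using J u by (simp add: m_assoc[symmetric])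
  moreover have "fst x \<in> Types \<alpha> - J \<and> snd x = u <# Sub \<alpha> (fst x)" if "x \<in> X" for x
  proof -
    have x: "x \<in> elements (system_of \<alpha>)" "x \<notin> ?F" using that X by (auto simp: residue_def)
    have eq: "fst x \<in> Types \<alpha>" "snd x = u <# Sub \<alpha> (fst x)"
      using element_at[OF x(1)] u(2) that by blast+
    \<comment> \<open>Otherwise \<open>x\<close> and the member of the flag of the same type both
      contain \<open>u\<close> and so coincide, whereas a residue excludes the members of the
      flag.\<close>
    have "fst x \<notin> J"
    proof
      assume j: "fst x \<in> J"
      then have m: "(fst x, g <# Sub \<alpha> (fst x)) \<in> ?F" by (auto simp: flag_at_def)
      then have "u \<in> g <# Sub \<alpha> (fst x)" using u(2) by force
      then have "g <# Sub \<alpha> (fst x) = u <# Sub \<alpha> (fst x)"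
        using l_coset_mem_eq subgroup_Sub eq(1) J(2) by blast
      then show False using m eq(2) x(2) by (metis prod.collapse)
    qed
    then show ?thesis using eq by blast
  qed
  ultimately show ?thesis by (intro bexI[of _ "inv g \<otimes> u"]) simp_all
qed

lemma elements_residue:
  assumes J: "J \<subseteq> Types \<alpha>" "g \<in> carrier G"
  shows "elements (residue (system_of \<alpha>) (flag_at \<alpha> J g)) =
    {(i, (g \<otimes> h) <# Sub \<alpha> i) | i h. i \<in> Types \<alpha> - J \<and> h \<in> parabolic \<alpha> J}" (is "?R = ?S")
proof (intro subset_antisym subsetI)
  fix x assume "x \<in> ?R"
  then have x: "{x} \<subseteq> ?R" by simp
  obtain h where "h \<in> parabolic \<alpha> J"
    "fst x \<in> Types \<alpha> - J" "snd x = (g \<otimes> h) <# Sub \<alpha> (fst x)"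
    using common_in_residue[OF J x pairwise_singleton] by blast
  then show "x \<in> ?S" by (cases x) auto
next
  fix x assume "x \<in> ?S"
  then obtain i h where x: "x = (i, (g \<otimes> h) <# Sub \<alpha> i)" "i \<in> Types \<alpha>" "i \<notin> J" "h \<in> parabolic \<alpha> J"
    by blast
  have h: "h \<in> carrier G" using x(4) by (simp add: parabolic_def)
  have "g \<otimes> h \<in> snd x" using x J h by (simp add: self_mem_l_coset subgroup_Sub)
  moreover have "g \<otimes> h \<in> g <# Sub \<alpha> j" if "j \<in> J" for j
    using that x(4) by (auto simp: l_coset_def parabolic_def)
  ultimately show "x \<in> ?R" using x J h by (auto simp: residue_def elements_iff flag_at_def)
qed

lemma corank_one_flagE:
  assumes "flag (system_of \<alpha>) F" "corank_one (system_of \<alpha>) F"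
  obtains i g where "i \<in> Types \<alpha>" "g \<in> carrier G" "F = flag_at \<alpha> (Types \<alpha> - {i}) g"
proof -
  obtain J g where J: "J \<subseteq> Types \<alpha>" "g \<in> carrier G" "F = flag_at \<alpha> J g" using assms(1) by (rule flagE)
  then obtain i where "Types \<alpha> - J = {i}"
    using assms(2) by (auto simp: corank_one_def card_1_singleton_iff)
  then have "i \<in> Types \<alpha>" "J = Types \<alpha> - {i}" using J(1) by blast+
  then show thesis using that J by blast
qed

lemma corank_one_flag_at:
  assumes "i \<in> Types \<alpha>" shows "corank_one (system_of \<alpha>) (flag_at \<alpha> (Types \<alpha> - {i}) g)"
proof -
  have "Types \<alpha> - (Types \<alpha> - {i}) = {i}" using assms by blast
  then show ?thesis by (simp add: corank_one_def)
qed

lemma elements_residue_corank_one: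
  assumes "i \<in> Types \<alpha>" "g \<in> carrier G"
  shows "elements (residue (system_of \<alpha>) (flag_at \<alpha> (Types \<alpha> - {i}) g)) =
    (\<lambda>h. (i, (g \<otimes> h) <# Sub \<alpha> i)) ` parabolic \<alpha> (Types \<alpha> - {i})"
  using assms by (subst elements_residue) auto

text \<open>The base point \<open>g\<close> of the flag cancels, so conditions on residues become
  conditions on parabolic subgroups alone.\<close>

lemma residue_coset_eq_iff:
  assumes "i \<in> Types \<alpha>" "g \<in> carrier G" "h \<in> carrier G" "k \<in> carrier G"
  shows "(g \<otimes> h) <# Sub \<alpha> i = (g \<otimes> k) <# Sub \<alpha> i \<longleftrightarrow> inv h \<otimes> k \<in> Sub \<alpha> i"
proof -
  have "inv (g \<otimes> h) \<otimes> (g \<otimes> k) = inv h \<otimes> (inv g \<otimes> g) \<otimes> k"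
    using assms by (simp only: inv_mult_group m_assoc m_closed inv_closed)
  then show ?thesis using assms by (simp add: l_coset_eq_iff subgroup_Sub)
qed

section \<open>Firmness and thinness in terms of parabolic subgroups\<close>

text \<open>By \<open>elements_residue_corank_one\<close> the residue is an orbit of cosets of
  \<open>Sub \<alpha> i\<close>, and by \<open>residue_coset_eq_iff\<close> it collapses to one
  element exactly when the parabolic subgroup of the other types lies in
  \<open>Sub \<alpha> i\<close>.\<close>

lemma firm_iff:
  "firm (system_of \<alpha>) \<longleftrightarrow> (\<forall>i\<in>Types \<alpha>. \<not> parabolic \<alpha> (Types \<alpha> - {i}) \<subseteq> Sub \<alpha> i)"
proof -
  let ?R = "\<lambda>i g. elements (residue (system_of \<alpha>) (flag_at \<alpha> (Types \<alpha> - {i}) g))"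
  have *: "infinite (?R i g) \<or> 2 \<le> card (?R i g) \<longleftrightarrow> \<not> parabolic \<alpha> (Types \<alpha> - {i}) \<subseteq> Sub \<alpha> i"
    if i: "i \<in> Types \<alpha>" and g: "g \<in> carrier G" for i g
  proof
    assume two: "infinite (?R i g) \<or> 2 \<le> card (?R i g)"
    show "\<not> parabolic \<alpha> (Types \<alpha> - {i}) \<subseteq> Sub \<alpha> i"
    proof
      assume sub: "parabolic \<alpha> (Types \<alpha> - {i}) \<subseteq> Sub \<alpha> i"
      have "(g \<otimes> h) <# Sub \<alpha> i = (g \<otimes> \<one>) <# Sub \<alpha> i" if "h \<in> parabolic \<alpha> (Types \<alpha> - {i})" for h
      proof -
        have "h \<in> carrier G" using that by (simp add: parabolic_def)
        then show ?thesis
          using that sub i g by (subst residue_coset_eq_iff) (auto intro: subgroup.m_inv_closed subgroup_Sub)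
      qed
      then have "?R i g \<subseteq> {(i, (g \<otimes> \<one>) <# Sub \<alpha> i)}"
        using elements_residue_corank_one[OF i g] by auto
      then have "?R i g = {} \<or> ?R i g = {(i, (g \<otimes> \<one>) <# Sub \<alpha> i)}" by (rule subset_singletonD)
      then show False using two by (elim disjE) simp_all
    qed
  next
    assume "\<not> parabolic \<alpha> (Types \<alpha> - {i}) \<subseteq> Sub \<alpha> i"
    then obtain h where h: "h \<in> parabolic \<alpha> (Types \<alpha> - {i})" "h \<notin> Sub \<alpha> i" by blast
    have hc: "h \<in> carrier G" using h by (simp add: parabolic_def)
    have one: "\<one> \<in> parabolic \<alpha> (Types \<alpha> - {i})" using subgroup_parabolic by (simp add: subgroup.one_closed)
    let ?x = "(i, (g \<otimes> \<one>) <# Sub \<alpha> i)" and ?y = "(i, (g \<otimes> h) <# Sub \<alpha> i)"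
    have "?x \<noteq> ?y" using residue_coset_eq_iff[OF i g one_closed hc] h hc by simp
    then have "card {?x, ?y} = 2" by simp
    moreover have "{?x, ?y} \<subseteq> ?R i g" using elements_residue_corank_one[OF i g] h one by auto
    ultimately show "infinite (?R i g) \<or> 2 \<le> card (?R i g)" by (metis card_mono)
  qed
  show ?thesis
  proof
    assume "firm (system_of \<alpha>)"
    then show "\<forall>i\<in>Types \<alpha>. \<not> parabolic \<alpha> (Types \<alpha> - {i}) \<subseteq> Sub \<alpha> i"
      using *[OF _ one_closed] corank_one_flag_at flag_flag_at[OF Diff_subset one_closed]
      unfolding firm_def by blast
  next
    assume "\<forall>i\<in>Types \<alpha>. \<not> parabolic \<alpha> (Types \<alpha> - {i}) \<subseteq> Sub \<alpha> i"
    then have "infinite (elements (residue (system_of \<alpha>) F)) \<or> 2 \<le> card (elements (residue (system_of \<alpha>) F))"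
      if "flag (system_of \<alpha>) F" "corank_one (system_of \<alpha>) F" for F
      using * by - (rule corank_one_flagE[OF that], simp)
    then show "firm (system_of \<alpha>)" using geometry by (simp add: firm_def)
  qed
qed

text \<open>Index two is expressed without counting: the part of the parabolic subgroup outside
  \<open>Sub \<alpha> i\<close> is nonempty and falls into a single coset.\<close>

lemma thin_iff:
  "thin (system_of \<alpha>) \<longleftrightarrow> (\<forall>i\<in>Types \<alpha>. \<not> parabolic \<alpha> (Types \<alpha> - {i}) \<subseteq> Sub \<alpha> i \<and>
    (\<forall>h\<in>parabolic \<alpha> (Types \<alpha> - {i}) - Sub \<alpha> i. \<forall>k\<in>parabolic \<alpha> (Types \<alpha> - {i}) - Sub \<alpha> i.
      inv h \<otimes> k \<in> Sub \<alpha> i))" (is "_ \<longleftrightarrow> (\<forall>i\<in>Types \<alpha>. ?T i)")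
proof -
  let ?R = "\<lambda>i g. elements (residue (system_of \<alpha>) (flag_at \<alpha> (Types \<alpha> - {i}) g))"
  have *: "card (?R i g) = 2 \<longleftrightarrow> ?T i" if i: "i \<in> Types \<alpha>" and g: "g \<in> carrier G" for i g
  proof -
    define P where "P = parabolic \<alpha> (Types \<alpha> - {i})"
    define c where "c = (\<lambda>h. (i, (g \<otimes> h) <# Sub \<alpha> i))"
    have P: "P \<subseteq> carrier G" "\<one> \<in> P"
      using subgroup.one_closed[OF subgroup_parabolic[OF Diff_subset]] by (auto simp: P_def parabolic_def)
    have R: "?R i g = c ` P" using elements_residue_corank_one[OF i g] by (simp add: c_def P_def)
    have c: "c h = c k \<longleftrightarrow> inv h \<otimes> k \<in> Sub \<alpha> i" if "h \<in> P" "k \<in> P" for h k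
      using residue_coset_eq_iff[OF i g] that P by (auto simp: c_def)
    have c1: "c \<one> = c h \<longleftrightarrow> h \<in> Sub \<alpha> i" if "h \<in> P" for h
      using c[OF P(2) that] that P by auto
    have "card (c ` P) = 2 \<longleftrightarrow>
      \<not> P \<subseteq> Sub \<alpha> i \<and> (\<forall>h\<in>P - Sub \<alpha> i. \<forall>k\<in>P - Sub \<alpha> i. c h = c k)"
    proof
      assume "card (c ` P) = 2"
      then obtain x y where xy: "c ` P = {x, y}" "x \<noteq> y" by (auto simp: card_2_iff)
      have "P \<subseteq> Sub \<alpha> i \<Longrightarrow> \<forall>h\<in>P. c h = c \<one>" using c1 by fastforce
      then have "\<not> P \<subseteq> Sub \<alpha> i" using xy by (metis imageE insertI1 insertI2)
      moreover have "c h = c k" if "h \<in> P - Sub \<alpha> i" "k \<in> P - Sub \<alpha> i" for h k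
      proof -
        have "c h \<in> {x, y}" "c k \<in> {x, y}" "c \<one> \<in> {x, y}" using that P(2) xy(1) by blast+
        moreover have "c \<one> \<noteq> c h" "c \<one> \<noteq> c k" using that c1 by auto
        ultimately show ?thesis by auto
      qed
      ultimately show "\<not> P \<subseteq> Sub \<alpha> i \<and> (\<forall>h\<in>P - Sub \<alpha> i. \<forall>k\<in>P - Sub \<alpha> i. c h = c k)" by blast
    next
      assume T: "\<not> P \<subseteq> Sub \<alpha> i \<and> (\<forall>h\<in>P - Sub \<alpha> i. \<forall>k\<in>P - Sub \<alpha> i. c h = c k)"
      then obtain h where h: "h \<in> P" "h \<notin> Sub \<alpha> i" by blast
      have "c k = c \<one> \<or> c k = c h" if "k \<in> P" for k
        using that T h c1[OF that] by (metis DiffI)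
      then have "c ` P = {c \<one>, c h}" using h P(2) by blast
      moreover have "c \<one> \<noteq> c h" using c1 h by blast
      ultimately show "card (c ` P) = 2" by simp
    qed
    then show ?thesis using c by (simp add: R P_def)
  qed
  show ?thesis
  proof
    assume "thin (system_of \<alpha>)"
    then show "\<forall>i\<in>Types \<alpha>. ?T i"
      using *[OF _ one_closed] corank_one_flag_at flag_flag_at[OF Diff_subset one_closed]
      unfolding thin_def by blast
  next
    assume "\<forall>i\<in>Types \<alpha>. ?T i"
    then have "card (elements (residue (system_of \<alpha>) F)) = 2"
      if "flag (system_of \<alpha>) F" "corank_one (system_of \<alpha>) F" for F
      using * by - (rule corank_one_flagE[OF that], simp)
    then show "thin (system_of \<alpha>)" using geometry by (simp add: thin_def)
  qed
qed

section \<open>Residual connectedness as a generation property\<close>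

text \<open>Generation is phrased through all subgroups \<open>H\<close> containing the groups
  \<open>parabolic \<alpha> (insert i J)\<close>. Along a path of the residue, representatives
  change only by factors from these groups; conversely, the members of
  \<open>parabolic \<alpha> J\<close> realised by paths form a subgroup containing them.\<close>

lemma connected_residue_iff:
  assumes J: "J \<subseteq> Types \<alpha>" "g \<in> carrier G" and ne: "Types \<alpha> - J \<noteq> {}"
  shows "connected_system (residue (system_of \<alpha>) (flag_at \<alpha> J g)) \<longleftrightarrow>
    (\<forall>H. subgroup H G \<and> (\<forall>i\<in>Types \<alpha> - J. parabolic \<alpha> (insert i J) \<subseteq> H) \<longrightarrow> parabolic \<alpha> J \<subseteq> H)"
    (is "connected_system ?\<Gamma> \<longleftrightarrow> (\<forall>H. ?gen H \<longrightarrow> _)")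
proof -
  define P where "P = parabolic \<alpha> J"
  define c where "c = (\<lambda>i h. (i, (g \<otimes> h) <# Sub \<alpha> i))"
  have subP: "subgroup P G" using J subgroup_parabolic by (simp add: P_def)
  have PG: "h \<in> carrier G" if "h \<in> P" for h using that by (simp add: P_def parabolic_def)
  have E: "x \<in> elements ?\<Gamma> \<longleftrightarrow> (\<exists>i\<in>Types \<alpha> - J. \<exists>h\<in>P. x = c i h)" for x
    using elements_residue[OF J] by (auto simp: c_def P_def)
  have c_eq: "c i h = c i k \<longleftrightarrow> inv h \<otimes> k \<in> parabolic \<alpha> (insert i J)"
    if "i \<in> Types \<alpha> - J" "h \<in> P" "k \<in> P" for i h k
  proof -
    have "inv h \<otimes> k \<in> P"
      using that subP by (simp add: subgroup.m_closed subgroup.m_inv_closed)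
    moreover have "c i h = c i k \<longleftrightarrow> inv h \<otimes> k \<in> Sub \<alpha> i"
      using residue_coset_eq_iff[of i g h k] J(2) that PG by (simp add: c_def)
    moreover have "parabolic \<alpha> (insert i J) = P \<inter> Sub \<alpha> i" by (auto simp: P_def parabolic_def)
    ultimately show ?thesis by blast
  qed
  \<comment> \<open>Adjacent elements have a common representative in \<open>P\<close>; this turns
    paths into products of group elements.\<close>
  have edge_common: "\<exists>h\<in>P. x = c (fst x) h \<and> y = c (fst y) h" if "(x, y) \<in> incidence_edges ?\<Gamma>" for x y
  proof -
    have "{x, y} \<subseteq> elements ?\<Gamma>" "pairwise (incident (system_of \<alpha>)) {x, y}"
      using that by (auto simp: incidence_edges_def pairwise_def)
    from common_in_residue[OF J this] show ?thesis by (auto simp: c_def P_def prod_eq_iff)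
  qed
  \<comment> \<open>The reflexive closure takes care of \<open>i = j\<close>, where both cosets are
    the same vertex.\<close>
  have edge: "(c i h, c j h) \<in> (incidence_edges ?\<Gamma>)\<^sup>*"
    if "i \<in> Types \<alpha> - J" "j \<in> Types \<alpha> - J" "h \<in> P" for i j h
  proof (cases "i = j")
    case False
    have "g \<otimes> h \<in> snd (c i h) \<inter> snd (c j h)"
      using that J PG by (auto simp: c_def intro!: self_mem_l_coset subgroup_Sub)
    moreover have "c i h \<noteq> c j h" using False by (simp add: c_def)
    moreover have "c i h \<in> elements ?\<Gamma>" "c j h \<in> elements ?\<Gamma>" using E that by blast+
    ultimately have "(c i h, c j h) \<in> incidence_edges ?\<Gamma>" by (auto simp: incidence_edges_def)
    then show ?thesis by blast
  qed simp
  have sym: "(y, x) \<in> (incidence_edges ?\<Gamma>)\<^sup>*" if "(x, y) \<in> (incidence_edges ?\<Gamma>)\<^sup>*" for x y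
    using that by (rule symD[OF sym_rtrancl, rotated]) (auto simp: sym_def incidence_edges_def)
  obtain i0 where i0: "i0 \<in> Types \<alpha> - J" using ne by blast
  have one: "\<one> \<in> P" using subP by (rule subgroup.one_closed)
  show ?thesis
  proof (intro iffI allI impI)
    fix H assume conn: "connected_system ?\<Gamma>" and H: "?gen H"
    have same: "k \<in> H" if "i \<in> Types \<alpha> - J" "h \<in> P" "k \<in> P" "c i h = c i k" "h \<in> H" for i h k
    proof -
      have "inv h \<otimes> k \<in> H" using c_eq that H by blast
      then have "h \<otimes> (inv h \<otimes> k) \<in> H" using that H by (blast intro: subgroup.m_closed)
      then show ?thesis using PG[of h] PG[of k] that by (simp add: m_assoc[symmetric])
    qed
    show "parabolic \<alpha> J \<subseteq> H"
    proof
      fix h assume "h \<in> parabolic \<alpha> J"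
      then have h: "h \<in> P" by (simp add: P_def)
      have "(c i0 \<one>, c i0 h) \<in> (incidence_edges ?\<Gamma>)\<^sup>*"
        using conn i0 h one E unfolding connected_system_def by blast
      \<comment> \<open>The invariant along the path is that each vertex has a representative in
        \<open>P \<inter> H\<close>. At an edge, \<open>k\<close> is exchanged for the
        representative \<open>k'\<close> common to both ends, and \<open>same\<close> keeps it in
        \<open>H\<close>.\<close>
      then have "\<exists>k\<in>P \<inter> H. c i0 h = c (fst (c i0 h)) k"
      proof (induction rule: rtrancl_induct)
        case base
        show ?case using one H by (auto simp: c_def dest: subgroup.one_closed)
      next
        case (step y z)
        then obtain k where k: "k \<in> P" "k \<in> H" "y = c (fst y) k" by blast
        obtain k' where k': "k' \<in> P" "y = c (fst y) k'" "z = c (fst z) k'"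
          using edge_common step.hyps(2) by blast
        have "y \<in> elements ?\<Gamma>" using step.hyps(2) by (simp add: incidence_edges_def)
        then have "fst y \<in> Types \<alpha> - J" using E by (auto simp: c_def)
        then have "k' \<in> H" using same[of "fst y" k k'] k k' by simp
        then show ?case using k' by blast
      qed
      then obtain k where "k \<in> P" "k \<in> H" "c i0 h = c i0 k" by (auto simp: c_def)
      then show "h \<in> H" using same i0 h by metis
    qed
  next
    assume gen: "\<forall>H. ?gen H \<longrightarrow> parabolic \<alpha> J \<subseteq> H"
    \<comment> \<open>Demanding a path from every \<open>c i0 k\<close>, and not only from the coset
      of the identity, makes closure under products and inverses immediate.\<close>
    define H where "H = {h \<in> P. \<forall>k\<in>P. (c i0 k, c i0 (k \<otimes> h)) \<in> (incidence_edges ?\<Gamma>)\<^sup>*}"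
    have "subgroup H G"
    proof (rule subgroupI)
      show "H \<subseteq> carrier G" using PG by (auto simp: H_def)
      have "\<one> \<in> H" using one PG by (simp add: H_def)
      then show "H \<noteq> {}" by blast
    next
      fix h assume "h \<in> H"
      then have h: "h \<in> P" "\<And>k. k \<in> P \<Longrightarrow> (c i0 k, c i0 (k \<otimes> h)) \<in> (incidence_edges ?\<Gamma>)\<^sup>*"
        by (simp_all add: H_def)
      have inv: "inv h \<in> P" using h subP by (simp add: subgroup.m_inv_closed)
      have "(c i0 k, c i0 (k \<otimes> inv h)) \<in> (incidence_edges ?\<Gamma>)\<^sup>*" if "k \<in> P" for k
      proof -
        have "k \<otimes> inv h \<in> P" using that inv subP by (simp add: subgroup.m_closed)
        moreover have "k \<otimes> inv h \<otimes> h = k" using that h PG by (simp add: m_assoc)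
        ultimately show ?thesis using h(2)[of "k \<otimes> inv h"] sym by simp
      qed
      then show "inv h \<in> H" using inv by (simp add: H_def)
    next
      fix h h' assume "h \<in> H" "h' \<in> H"
      then show "h \<otimes> h' \<in> H" using subP PG
        by (auto simp: H_def subgroup.m_closed m_assoc[symmetric] intro: rtrancl_trans)
    qed
    moreover have "parabolic \<alpha> (insert i J) \<subseteq> H" if i: "i \<in> Types \<alpha> - J" for i
    proof
      fix h assume h: "h \<in> parabolic \<alpha> (insert i J)"
      then have hP: "h \<in> P" by (simp add: P_def parabolic_def)
      have "(c i0 k, c i0 (k \<otimes> h)) \<in> (incidence_edges ?\<Gamma>)\<^sup>*" if k: "k \<in> P" for k
      proof -
        have kh: "k \<otimes> h \<in> P" using k hP subP by (simp add: subgroup.m_closed)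
        have "inv k \<otimes> (k \<otimes> h) = h" using k hP PG by (simp add: m_assoc[symmetric])
        \<comment> \<open>Right multiplication by \<open>h\<close> fixes this coset of type
          \<open>i\<close>, which therefore links \<open>c i0 k\<close> to
          \<open>c i0 (k \<otimes> h)\<close>.\<close>
        then have "c i k = c i (k \<otimes> h)" using c_eq[OF i k kh] h by simp
        then show ?thesis using edge[OF i0 i k] edge[OF i i0 kh] by (simp add: rtrancl_trans)
      qed
      then show "h \<in> H" using hP by (simp add: H_def)
    qed
    ultimately have PH: "P \<subseteq> H" using gen by (auto simp: P_def)
    have "(x, c i0 \<one>) \<in> (incidence_edges ?\<Gamma>)\<^sup>*" if x: "x \<in> elements ?\<Gamma>" for x
    proof -
      obtain i h where i: "i \<in> Types \<alpha> - J" "h \<in> P" "x = c i h" using x E by blast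
      then have "h \<in> H" using PH by blast
      then have "(c i0 \<one>, c i0 h) \<in> (incidence_edges ?\<Gamma>)\<^sup>*" using one i PG by (force simp: H_def)
      then show ?thesis using edge[OF i(1) i0 i(2)] i sym rtrancl_trans by metis
    qed
    then have "\<forall>x\<in>elements ?\<Gamma>. \<forall>y\<in>elements ?\<Gamma>. (x, y) \<in> (incidence_edges ?\<Gamma>)\<^sup>*"
      using sym rtrancl_trans by metis
    moreover have "c i0 \<one> \<in> elements ?\<Gamma>" using E i0 one by blast
    ultimately show "connected_system ?\<Gamma>" unfolding connected_system_def by blast
  qed
qed

lemma residually_connected_iff:
  "residually_connected (system_of \<alpha>) \<longleftrightarrow>
    (\<forall>J\<subseteq>Types \<alpha>. infinite (Types \<alpha> - J) \<or> 2 \<le> card (Types \<alpha> - J) \<longrightarrow>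
      (\<forall>H. subgroup H G \<and> (\<forall>i\<in>Types \<alpha> - J. parabolic \<alpha> (insert i J) \<subseteq> H) \<longrightarrow> parabolic \<alpha> J \<subseteq> H))"
    (is "_ \<longleftrightarrow> (\<forall>J\<subseteq>Types \<alpha>. ?two J \<longrightarrow> ?gen J)")
proof -
  \<comment> \<open>\<open>connected_residue_iff\<close> needs some type outside \<open>J\<close>,
    which rank at least two provides.\<close>
  have ne: "Types \<alpha> - J \<noteq> {}" if "?two J" for J using that by (metis card.empty finite.emptyI not_numeral_le_zero)
  have two: "rank_at_least_two (residue (system_of \<alpha>) (flag_at \<alpha> J g)) \<longleftrightarrow> ?two J" for J g
    by (simp add: rank_at_least_two_def)
  show ?thesis
  proof (intro iffI allI impI)
    fix J H assume "residually_connected (system_of \<alpha>)" and J: "J \<subseteq> Types \<alpha>" "?two J"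
      and H: "subgroup H G \<and> (\<forall>i\<in>Types \<alpha> - J. parabolic \<alpha> (insert i J) \<subseteq> H)"
    then have "connected_system (residue (system_of \<alpha>) (flag_at \<alpha> J \<one>))"
      using two[of J \<one>] flag_flag_at[OF J(1) one_closed] unfolding residually_connected_def by blast
    then show "parabolic \<alpha> J \<subseteq> H" using H connected_residue_iff[OF J(1) one_closed ne[OF J(2)]] by blast
  next
    assume *: "\<forall>J\<subseteq>Types \<alpha>. ?two J \<longrightarrow> ?gen J"
    have "connected_system (residue (system_of \<alpha>) F)"
      if F: "flag (system_of \<alpha>) F" "rank_at_least_two (residue (system_of \<alpha>) F)" for F
    proof -
      obtain J g where J: "J \<subseteq> Types \<alpha>" "g \<in> carrier G" "F = flag_at \<alpha> J g" using F(1) by (rule flagE)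
      then have "?two J" using F(2) two by blast
      then show ?thesis
        unfolding J(3) connected_residue_iff[OF J(1,2) ne[OF \<open>?two J\<close>]] using *[rule_format, OF J(1)] by blast
    qed
    then show "residually_connected (system_of \<alpha>)" using geometry by (simp add: residually_connected_def)
  qed
qed

text \<open>Induction on the corank of \<open>X \<inter> Y\<close>. If neither set contains the
  other, adding a type \<open>i\<close> outside \<open>X \<inter> Y\<close> to both gives sets that
  meet in \<open>insert i (X \<inter> Y)\<close>, of smaller corank. Residual connectedness at
  \<open>X \<inter> Y\<close> combines the results for all \<open>i\<close>.\<close>

lemma parabolic_Int_subset:
  assumes rc: "residually_connected (system_of \<alpha>)" and fin: "finite (Types \<alpha>)"
    and H: "subgroup H G"
  shows "X \<subseteq> Types \<alpha> \<Longrightarrow> Y \<subseteq> Types \<alpha> \<Longrightarrow> parabolic \<alpha> X \<subseteq> H \<Longrightarrow> parabolic \<alpha> Y \<subseteq> H \<Longrightarrow>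
    parabolic \<alpha> (X \<inter> Y) \<subseteq> H"
proof (induction "card (Types \<alpha> - X \<inter> Y)" arbitrary: X Y rule: less_induct)
  case less
  consider "X \<inter> Y = X" | "X \<inter> Y = Y" | x y where "x \<in> X - Y" "y \<in> Y - X" by blast
  then show ?case
  proof cases
    case 3
    have "parabolic \<alpha> (insert i (X \<inter> Y)) \<subseteq> H" if i: "i \<in> Types \<alpha> - X \<inter> Y" for i
    proof -
      have "Types \<alpha> - insert i X \<inter> insert i Y \<subset> Types \<alpha> - X \<inter> Y" using i by blast
      then have "card (Types \<alpha> - insert i X \<inter> insert i Y) < card (Types \<alpha> - X \<inter> Y)"
        using fin by (meson finite_Diff psubset_card_mono)
      then have "parabolic \<alpha> (insert i X \<inter> insert i Y) \<subseteq> H"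
        using i less.prems parabolic_antimono[OF subset_insertI, of \<alpha> i] by (intro less.hyps) blast+
      then show ?thesis by simp
    qed
    \<comment> \<open>Both \<open>x\<close> and \<open>y\<close> lie outside
      \<open>X \<inter> Y\<close>, so the corank is at least two, as residual connectedness
      demands.\<close>
    moreover have "card {x, y} \<le> card (Types \<alpha> - X \<inter> Y)"
      using 3 fin less.prems by (intro card_mono) auto
    moreover have "card {x, y} = 2" using 3 by (metis DiffE card_2_iff)
    ultimately show ?thesis
      using rc[unfolded residually_connected_iff, rule_format, of "X \<inter> Y" H] H less.prems by auto
  qed (use less.prems in simp_all)
qed

lemma parabolic_Inter_subset:
  assumes rc: "residually_connected (system_of \<alpha>)" and fin: "finite (Types \<alpha>)"
    and H: "subgroup H G"
    and X: "\<X> \<noteq> {}" "\<And>X. X \<in> \<X> \<Longrightarrow> X \<subseteq> Types \<alpha>" "\<And>X. X \<in> \<X> \<Longrightarrow> parabolic \<alpha> X \<subseteq> H"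
  shows "parabolic \<alpha> (\<Inter>\<X>) \<subseteq> H"
proof -
  have "finite \<X>" using X(2) fin by (metis PowI finite_Pow_iff finite_subset subsetI)
  then show ?thesis using X
  proof (induction rule: finite_ne_induct)
    case (insert X \<X>)
    then have "\<Inter>\<X> \<subseteq> Types \<alpha>" by blast
    then show ?case using insert by (simp add: parabolic_Int_subset[OF rc fin H])
  qed simp
qed

end

section \<open>The twisting\<close>

locale twisting_data =
  A: flag_transitive_coset_incidence A \<alpha> + B: flag_transitive_coset_incidence B \<beta>
  for A :: "'a monoid" and \<alpha> :: "('a, 'i) coset_system"
    and B :: "'b monoid" and \<beta> :: "('b, 'j) coset_system" +
  fixes \<phi> :: "'b \<Rightarrow> 'a \<Rightarrow> 'a" and L :: "'i set" and F0 :: 'i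
  assumes hom_\<phi>: "\<phi> \<in> hom B (AutoGroup A)"
    and admissible: "admissible \<alpha> \<beta> \<phi> L F0"
begin

abbreviation "G \<equiv> semidirect A B \<phi>"
abbreviation "T \<equiv> twisting \<alpha> \<beta> \<phi> L F0"
abbreviation "K \<equiv> type_orbits \<alpha> \<beta> \<phi>"

section \<open>The action on \<open>A\<close> and the induced action on its types\<close>

lemma \<phi>_auto:
  assumes "b \<in> carrier B"
  shows "\<phi> b \<in> hom A A" "bij_betw (\<phi> b) (carrier A) (carrier A)"
  using assms hom_\<phi> by (auto simp: hom_def AutoGroup_def BijGroup_def auto_def Bij_def)

lemma \<phi>_closed [simp]: "b \<in> carrier B \<Longrightarrow> a \<in> carrier A \<Longrightarrow> \<phi> b a \<in> carrier A"
  using \<phi>_auto(1) by (auto simp: hom_def)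

lemma \<phi>_mult: "b \<in> carrier B \<Longrightarrow> a \<in> carrier A \<Longrightarrow> a' \<in> carrier A \<Longrightarrow>
    \<phi> b (a \<otimes>\<^bsub>A\<^esub> a') = \<phi> b a \<otimes>\<^bsub>A\<^esub> \<phi> b a'"
  using \<phi>_auto(1) by (auto simp: hom_def)

lemma \<phi>_one [simp]: "b \<in> carrier B \<Longrightarrow> \<phi> b \<one>\<^bsub>A\<^esub> = \<one>\<^bsub>A\<^esub>"
  using hom_one[OF \<phi>_auto(1)] A.is_group by blast

lemma \<phi>_comp:
  assumes "b \<in> carrier B" "c \<in> carrier B" "a \<in> carrier A"
  shows "\<phi> (b \<otimes>\<^bsub>B\<^esub> c) a = \<phi> b (\<phi> c a)"
proof -
  have in_Bij: "\<phi> x \<in> Bij (carrier A)" if "x \<in> carrier B" for x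
    using that hom_\<phi> by (auto simp: hom_def AutoGroup_def BijGroup_def auto_def)
  \<comment> \<open>Multiplication in \<open>BijGroup\<close> is \<open>compose\<close>, restricted
    to members of \<open>Bij\<close>; this is why \<open>in_Bij\<close> is needed, and why the
    result holds only on the carrier.\<close>
  have "\<phi> (b \<otimes>\<^bsub>B\<^esub> c) = compose (carrier A) (\<phi> b) (\<phi> c)"
    using hom_mult[OF hom_\<phi> assms(1,2)] in_Bij assms by (simp add: AutoGroup_def BijGroup_def)
  then show ?thesis using assms by (simp add: compose_def)
qed

lemma \<phi>_one_left [simp]: assumes "a \<in> carrier A" shows "\<phi> \<one>\<^bsub>B\<^esub> a = a"
proof -
  \<comment> \<open>The image of the identity is idempotent; injectivity on the carrier then cancels
    one application.\<close>
  have "\<phi> \<one>\<^bsub>B\<^esub> (\<phi> \<one>\<^bsub>B\<^esub> a) = \<phi> \<one>\<^bsub>B\<^esub> a"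
    using \<phi>_comp[of "\<one>\<^bsub>B\<^esub>" "\<one>\<^bsub>B\<^esub>" a] assms by simp
  then show ?thesis
    using \<phi>_auto(2)[OF B.one_closed] assms by (auto simp: bij_betw_def inj_on_eq_iff)
qed

lemma \<phi>_image_comp:
  assumes "b \<in> carrier B" "c \<in> carrier B" "X \<subseteq> carrier A"
  shows "\<phi> (b \<otimes>\<^bsub>B\<^esub> c) ` X = \<phi> b ` \<phi> c ` X"
  using assms by (auto simp: image_image \<phi>_comp subset_iff intro!: image_cong)

lemma Sub_subset: "i \<in> Types \<alpha> \<Longrightarrow> Sub \<alpha> i \<subseteq> carrier A"
  by (rule subgroup.subset[OF A.subgroup_Sub])

text \<open>This is the action written \<open>i\<^sup>b\<close> in the definitions. The description
  is well-defined by the first clause of admissibility, see \<open>ex1_act\<close>.\<close>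

definition act :: "'b \<Rightarrow> 'i \<Rightarrow> 'i" where
  "act b i = (THE j. j \<in> Types \<alpha> \<and> \<phi> b ` Sub \<alpha> i = Sub \<alpha> j)"

lemma ex1_act:
  assumes "b \<in> carrier B" "i \<in> Types \<alpha>" shows "\<exists>!j. j \<in> Types \<alpha> \<and> \<phi> b ` Sub \<alpha> i = Sub \<alpha> j"
  using admissible assms by (simp add: admissible_def)

lemma act:
  assumes "b \<in> carrier B" "i \<in> Types \<alpha>"
  shows act_closed: "act b i \<in> Types \<alpha>" and Sub_act: "\<phi> b ` Sub \<alpha> i = Sub \<alpha> (act b i)"
  using theI'[OF ex1_act[OF assms]] by (simp_all add: act_def)

lemma act_eqI: "b \<in> carrier B \<Longrightarrow> i \<in> Types \<alpha> \<Longrightarrow> j \<in> Types \<alpha> \<Longrightarrow> \<phi> b ` Sub \<alpha> i = Sub \<alpha> j \<Longrightarrow> act b i = j"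
  unfolding act_def by (rule the1_equality[OF ex1_act]) auto

lemma act_one: assumes "i \<in> Types \<alpha>" shows "act \<one>\<^bsub>B\<^esub> i = i"
proof (rule act_eqI[OF B.one_closed assms assms])
  have "\<phi> \<one>\<^bsub>B\<^esub> ` Sub \<alpha> i = (\<lambda>x. x) ` Sub \<alpha> i"
    using Sub_subset[OF assms] by (intro image_cong) auto
  then show "\<phi> \<one>\<^bsub>B\<^esub> ` Sub \<alpha> i = Sub \<alpha> i" by simp
qed

lemma act_one_image: assumes "X \<subseteq> Types \<alpha>" shows "act \<one>\<^bsub>B\<^esub> ` X = X"
proof -
  have "act \<one>\<^bsub>B\<^esub> ` X = (\<lambda>x. x) ` X" using assms act_one by (intro image_cong) auto
  then show ?thesis by simp
qed

lemma act_mult: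
  assumes "b \<in> carrier B" "c \<in> carrier B" "i \<in> Types \<alpha>"
  shows "act (b \<otimes>\<^bsub>B\<^esub> c) i = act b (act c i)"
proof (rule act_eqI)
  show "\<phi> (b \<otimes>\<^bsub>B\<^esub> c) ` Sub \<alpha> i = Sub \<alpha> (act b (act c i))"
    using \<phi>_image_comp[OF assms(1,2) Sub_subset[OF assms(3)]]
    unfolding Sub_act[OF assms(2,3)] Sub_act[OF assms(1) act_closed[OF assms(2,3)]] .
qed (use assms act_closed in simp_all)

lemma act_inv:
  assumes "b \<in> carrier B" "i \<in> Types \<alpha>"
  shows "act b (act (inv\<^bsub>B\<^esub> b) i) = i" "act (inv\<^bsub>B\<^esub> b) (act b i) = i"
  using assms act_mult[of b "inv\<^bsub>B\<^esub> b" i] act_mult[of "inv\<^bsub>B\<^esub> b" b i] act_one by simp_all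

lemma act_inj: "b \<in> carrier B \<Longrightarrow> i \<in> Types \<alpha> \<Longrightarrow> j \<in> Types \<alpha> \<Longrightarrow> act b i = act b j \<Longrightarrow> i = j"
  using act_inv(2) by metis

text \<open>The identity fixes all types, but equal subgroups would make it send \<open>i\<close> to
  \<open>j\<close>. This bounds the number of types by the number of cosets.\<close>

lemma inj_on_Sub: "inj_on (Sub \<alpha>) (Types \<alpha>)"
proof (rule inj_onI)
  fix i j assume "i \<in> Types \<alpha>" "j \<in> Types \<alpha>" "Sub \<alpha> i = Sub \<alpha> j"
  then show "i = j"
    using act_eqI[OF B.one_closed, of i j] act(2)[OF B.one_closed, of i] by (simp add: act_one)
qed

lemma type_orbit_eq:
  assumes "S \<subseteq> carrier B" "i \<in> Types \<alpha>" shows "type_orbit \<alpha> \<phi> S i = (\<lambda>b. act b i) ` S"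
proof (intro subset_antisym subsetI)
  fix j assume "j \<in> type_orbit \<alpha> \<phi> S i"
  then obtain b where "j \<in> Types \<alpha>" "b \<in> S" "\<phi> b ` Sub \<alpha> i = Sub \<alpha> j" by (auto simp: type_orbit_def)
  moreover from this have "act b i = j" using assms by (intro act_eqI) auto
  ultimately show "j \<in> (\<lambda>b. act b i) ` S" by blast
next
  fix j assume "j \<in> (\<lambda>b. act b i) ` S"
  then obtain b where "b \<in> S" "j = act b i" by blast
  moreover from this have "b \<in> carrier B" using assms by blast
  ultimately show "j \<in> type_orbit \<alpha> \<phi> S i"
    using act[of b i] assms(2) by (auto simp: type_orbit_def)
qed

text \<open>An injective map commutes with intersections of subsets of the carrier; surjectivity
  onto \<open>carrier A\<close> covers an empty \<open>X\<close>.\<close>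

lemma \<phi>_parabolic:
  assumes b: "b \<in> carrier B" and X: "X \<subseteq> Types \<alpha>"
  shows "\<phi> b ` parabolic \<alpha> X = parabolic \<alpha> (act b ` X)"
proof -
  have inj: "inj_on (\<phi> b) (carrier A)" and im: "\<phi> b ` carrier A = carrier A"
    using \<phi>_auto(2)[OF b] by (auto simp: bij_betw_def)
  have "\<phi> b a \<in> parabolic \<alpha> (act b ` X) \<longleftrightarrow> a \<in> parabolic \<alpha> X" if a: "a \<in> carrier A" for a
  proof -
    have "\<phi> b a \<in> Sub \<alpha> (act b i) \<longleftrightarrow> a \<in> Sub \<alpha> i" if "i \<in> X" for i
    proof -
      have i: "i \<in> Types \<alpha>" using that X by blast
      show ?thesis
        using inj_on_image_mem_iff[OF inj a Sub_subset[OF i]] act(2)[OF b i] by simp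
    qed
    then show ?thesis using a b by (simp add: parabolic_def)
  qed
  then show ?thesis
    using im A.parabolic_subset_carrier by (auto simp: image_iff subset_iff) (metis imageE)
qed

text \<open>Inclusion for all members of a subgroup suffices, since the inverse of \<open>b\<close>
  gives the reverse inclusion.\<close>

lemma act_image_eq:
  assumes S: "subgroup S B" and X: "X \<subseteq> Types \<alpha>" and sub: "\<And>b. b \<in> S \<Longrightarrow> act b ` X \<subseteq> X" and b: "b \<in> S"
  shows "act b ` X = X"
proof
  have bB: "b \<in> carrier B" using S b by (rule subgroup.mem_carrier)
  show "X \<subseteq> act b ` X"
  proof
    fix x assume x: "x \<in> X"
    then have "act (inv\<^bsub>B\<^esub> b) x \<in> X" using sub subgroup.m_inv_closed[OF S b] by blast
    moreover have "act b (act (inv\<^bsub>B\<^esub> b) x) = x" using act_inv(1) bB x X by blast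
    ultimately show "x \<in> act b ` X" by force
  qed
qed (rule sub[OF b])

lemma act_type_orbit:
  assumes S: "subgroup S B" and i: "i \<in> Types \<alpha>" and b: "b \<in> S"
  shows "act b ` type_orbit \<alpha> \<phi> S i = type_orbit \<alpha> \<phi> S i"
proof (rule act_image_eq[OF S _ _ b])
  note eq = type_orbit_eq[OF subgroup.subset[OF S] i]
  show "type_orbit \<alpha> \<phi> S i \<subseteq> Types \<alpha>" by (auto simp: type_orbit_def)
  show "act c ` type_orbit \<alpha> \<phi> S i \<subseteq> type_orbit \<alpha> \<phi> S i" if "c \<in> S" for c
    using that subgroup.subset[OF S] subgroup.m_closed[OF S] i
    by (auto simp: eq act_mult[symmetric] subset_iff)
qed

section \<open>Orbits of types and the base point \<open>F0\<close>\<close>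

lemma orbit_eq:
  assumes "k \<in> K" "x \<in> k" shows "x \<in> Types \<alpha>" "k = type_orbit \<alpha> \<phi> (carrier B) x"
proof -
  obtain i where i: "i \<in> Types \<alpha>" "k = (\<lambda>b. act b i) ` carrier B"
    using assms by (auto simp: type_orbits_def type_orbit_eq)
  then obtain c where c: "c \<in> carrier B" "x = act c i" using assms by blast
  show x: "x \<in> Types \<alpha>" using i c act by blast
  have "k = (\<lambda>b. act b x) ` carrier B"
  proof (intro subset_antisym subsetI)
    fix j assume "j \<in> k"
    then obtain b where b: "b \<in> carrier B" "j = act b i" using i by blast
    then have "j = act (b \<otimes>\<^bsub>B\<^esub> inv\<^bsub>B\<^esub> c) x"
      using i c by (simp add: act_mult act_inv act_closed)
    then show "j \<in> (\<lambda>b. act b x) ` carrier B" using b c by blast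
  next
    fix j assume "j \<in> (\<lambda>b. act b x) ` carrier B"
    then obtain b where b: "b \<in> carrier B" "j = act b x" by blast
    then have "j = act (b \<otimes>\<^bsub>B\<^esub> c) i" using i c by (simp add: act_mult)
    then show "j \<in> k" using i b c by blast
  qed
  then show "k = type_orbit \<alpha> \<phi> (carrier B) x" using x by (simp add: type_orbit_eq)
qed

lemma orbit_subset: "k \<in> K \<Longrightarrow> k \<subseteq> Types \<alpha>"
  using orbit_eq(1) by blast

lemma orbits_disjoint: "k \<in> K \<Longrightarrow> k' \<in> K \<Longrightarrow> x \<in> k \<Longrightarrow> x \<in> k' \<Longrightarrow> k = k'"
  using orbit_eq(2) by metis

lemma orbit_ne: assumes "k \<in> K" shows "k \<noteq> {}"
  using assms by (auto simp: type_orbits_def type_orbit_eq)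

lemma ex_orbit:
  assumes "i \<in> Types \<alpha>" shows "\<exists>k\<in>K. i \<in> k"
proof
  show "type_orbit \<alpha> \<phi> (carrier B) i \<in> K" using assms by (simp add: type_orbits_def)
  show "i \<in> type_orbit \<alpha> \<phi> (carrier B) i"
    using assms act_one by (force simp: type_orbit_eq)
qed

lemma L_in_K: "L \<in> K" and F0_in_L: "F0 \<in> L"
  using admissible by (auto simp: admissible_def)

lemma F0_type: "F0 \<in> Types \<alpha>" and L_eq: "L = type_orbit \<alpha> \<phi> (carrier B) F0"
  using orbit_eq L_in_K F0_in_L by auto

lemma orbit_singleton:
  assumes "k \<in> K" "k \<noteq> L" "l \<in> k" shows "k = {l}"
proof -
  have "finite k \<and> card k \<le> 1" using admissible assms unfolding admissible_def by (meson not_le)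
  then show ?thesis using assms(3) by (metis One_nat_def card_le_Suc0_iff_eq is_singletonI' is_singleton_the_elem singletonD empty_iff)
qed

abbreviation "orb i \<equiv> type_orbit \<alpha> \<phi> (Sub \<beta> i) F0"

text \<open>The identity of \<open>Sub \<beta> i\<close> fixes \<open>F0\<close>. Hence
  \<open>F0\<close> is in no \<open>L - orb i\<close>, which makes it the exceptional type of
  \<open>L\<close> in the covering arguments below.\<close>

lemma F0_orb: assumes "i \<in> Types \<beta>" shows "F0 \<in> orb i"
proof -
  have "\<one>\<^bsub>B\<^esub> \<in> Sub \<beta> i" by (rule subgroup.one_closed[OF B.subgroup_Sub[OF assms]])
  moreover have "Sub \<beta> i \<subseteq> carrier B" by (rule subgroup.subset[OF B.subgroup_Sub[OF assms]])
  ultimately show ?thesis using act_one F0_type by (force simp: type_orbit_eq)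
qed

text \<open>This is the only use of condition (3) of admissibility.\<close>

lemma mem_parabolic_type_orbit:
  assumes "finite M" "M \<subseteq> Types \<beta>" "x \<in> L" "\<And>i. i \<in> M \<Longrightarrow> x \<in> orb i"
  shows "x \<in> type_orbit \<alpha> \<phi> (parabolic \<beta> M) F0"
  using assms
proof (induction M rule: finite_induct)
  case empty
  then show ?case using L_eq by (simp add: parabolic_def)
next
  case (insert i M)
  \<comment> \<open>\<open>parabolic_orbit\<close> is indexed by complements, so condition (3) turns
    an intersection of orbits into the orbit for the union of the type sets, here \<open>M\<close>
    and \<open>{i}\<close>.\<close>
  have eq: "parabolic_orbit \<alpha> \<beta> \<phi> F0 (Types \<beta> - N) = type_orbit \<alpha> \<phi> (parabolic \<beta> N) F0"
    if "N \<subseteq> Types \<beta>" for N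
    using that by (simp add: parabolic_orbit_def double_diff)
  have "x \<in> parabolic_orbit \<alpha> \<beta> \<phi> F0 (Types \<beta> - M) \<inter> parabolic_orbit \<alpha> \<beta> \<phi> F0 (Types \<beta> - {i})"
    using insert by (simp add: eq B.parabolic_single)
  also have "\<dots> = parabolic_orbit \<alpha> \<beta> \<phi> F0 ((Types \<beta> - M) \<inter> (Types \<beta> - {i}))"
    using admissible unfolding admissible_def by blast
  also have "(Types \<beta> - M) \<inter> (Types \<beta> - {i}) = Types \<beta> - insert i M" by blast
  finally show ?case using insert.prems eq by blast
qed

section \<open>The subgroups of the twisting as products of parabolic subgroups\<close>

text \<open>With \<open>rtypes\<close>, this treats both kinds of types uniformly: by
  \<open>Sub_twisting\<close> each subgroup is a product of two parabolic subgroups. For an orbit,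
  the empty \<open>rtypes\<close> gives all of \<open>carrier B\<close>.\<close>

definition ltypes :: "'j + 'i set \<Rightarrow> 'i set" where
  "ltypes t = (case t of Inl i \<Rightarrow> L - orb i | Inr k \<Rightarrow> k)"

definition rtypes :: "'j + 'i set \<Rightarrow> 'j set" where
  "rtypes t = (case t of Inl i \<Rightarrow> {i} | Inr k \<Rightarrow> {})"

lemma ltypes_simps [simp]: "ltypes (Inl i) = L - orb i" "ltypes (Inr k) = k"
  and rtypes_simps [simp]: "rtypes (Inl i) = {i}" "rtypes (Inr k) = {}"
  by (simp_all add: ltypes_def rtypes_def)

lemma mem_rtypes_iff: "j \<in> rtypes t \<longleftrightarrow> t = Inl j"
  by (cases t) auto

lemma Types_twisting [simp]: "Types T = Types \<beta> <+> K"
  and Grp_twisting [simp]: "Grp T = G"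
  by (simp_all add: twisting_def)

lemma ltypes_subset: "t \<in> Types T \<Longrightarrow> ltypes t \<subseteq> Types \<alpha>"
  using orbit_subset L_in_K by fastforce

lemma rtypes_subset: "t \<in> Types T \<Longrightarrow> rtypes t \<subseteq> Types \<beta>"
  by auto

lemma Sub_twisting: "t \<in> Types T \<Longrightarrow> Sub T t = parabolic \<alpha> (ltypes t) \<times> parabolic \<beta> (rtypes t)"
  by (auto simp: twisting_def B.parabolic_single) (simp_all add: parabolic_def)

text \<open>This is what makes the products in \<open>Sub_twisting\<close> subgroups: the second
  factor must preserve the first. Members of \<open>Sub \<beta> i\<close> preserve both
  \<open>L\<close> and \<open>orb i\<close>, and an orbit \<open>k\<close> is preserved by all of
  \<open>B\<close>.\<close>

lemma act_ltypes:
  assumes t: "t \<in> Types T" and b: "b \<in> parabolic \<beta> (rtypes t)"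
  shows "act b ` ltypes t = ltypes t"
proof (cases t)
  case (Inl i)
  then have i: "i \<in> Types \<beta>" using t by auto
  note S = B.subgroup_Sub[OF i]
  have bS: "b \<in> Sub \<beta> i" using b Inl i by (simp add: B.parabolic_single)
  then have bB: "b \<in> carrier B" using S subgroup.mem_carrier by metis
  have L: "act b ` L = L" using act_type_orbit[OF B.subgroup_self F0_type bB] L_eq by simp
  have "orb i \<subseteq> Types \<alpha>" by (auto simp: type_orbit_def)
  then have "inj_on (act b) (L \<union> orb i)"
    using orbit_subset[OF L_in_K] act_inj[OF bB] by (intro inj_onI) blast
  then have "act b ` (L - orb i) = act b ` L - act b ` orb i" by (rule inj_on_image_set_diff) auto
  then show ?thesis using L act_type_orbit[OF S F0_type bS] Inl by simp
next
  case (Inr k)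
  then have k: "k \<in> K" using t by auto
  obtain x where "x \<in> k" using orbit_ne[OF k] by blast
  note orbit_eq[OF k this]
  moreover have "b \<in> carrier B" using b by (simp add: parabolic_def)
  ultimately show ?thesis using act_type_orbit[OF B.subgroup_self] Inr by simp
qed

section \<open>The semidirect product: group laws, subgroups and cosets\<close>

lemma semidirect_simps [simp]:
  "carrier G = carrier A \<times> carrier B" "\<one>\<^bsub>G\<^esub> = (\<one>\<^bsub>A\<^esub>, \<one>\<^bsub>B\<^esub>)"
  "(a, b) \<otimes>\<^bsub>G\<^esub> (a', b') = (a \<otimes>\<^bsub>A\<^esub> \<phi> b a', b \<otimes>\<^bsub>B\<^esub> b')"
  by (simp_all add: semidirect_def)

lemma \<phi>_inv:
  assumes "a \<in> carrier A" "b \<in> carrier B"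
  shows "\<phi> b (\<phi> (inv\<^bsub>B\<^esub> b) a) = a" "\<phi> (inv\<^bsub>B\<^esub> b) (\<phi> b a) = a"
  using assms by (simp_all add: \<phi>_comp[symmetric])

lemma semidirect_l_inv:
  assumes "a \<in> carrier A" "b \<in> carrier B"
  shows "(\<phi> (inv\<^bsub>B\<^esub> b) (inv\<^bsub>A\<^esub> a), inv\<^bsub>B\<^esub> b) \<otimes>\<^bsub>G\<^esub> (a, b) = \<one>\<^bsub>G\<^esub>"
  using assms by (simp add: \<phi>_mult[symmetric])

lemma group_semidirect: "group G"
proof (rule groupI)
  fix x y z assume "x \<in> carrier G" "y \<in> carrier G" "z \<in> carrier G"
  then show "x \<otimes>\<^bsub>G\<^esub> y \<otimes>\<^bsub>G\<^esub> z = x \<otimes>\<^bsub>G\<^esub> (y \<otimes>\<^bsub>G\<^esub> z)"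
    by (auto simp: \<phi>_mult \<phi>_comp A.m_assoc B.m_assoc)
next
  fix x assume "x \<in> carrier G"
  then show "\<exists>y\<in>carrier G. y \<otimes>\<^bsub>G\<^esub> x = \<one>\<^bsub>G\<^esub>"
    using semidirect_l_inv by (cases x) (force simp del: semidirect_simps(2,3))
qed auto

lemma inv_semidirect:
  assumes "a \<in> carrier A" "b \<in> carrier B"
  shows "inv\<^bsub>G\<^esub> (a, b) = (\<phi> (inv\<^bsub>B\<^esub> b) (inv\<^bsub>A\<^esub> a), inv\<^bsub>B\<^esub> b)"
  using group.inv_equality[OF group_semidirect semidirect_l_inv[OF assms]] assms by simp

lemma inv_mult_semidirect:
  assumes "a \<in> carrier A" "b \<in> carrier B" "a' \<in> carrier A" "b' \<in> carrier B"
  shows "inv\<^bsub>G\<^esub> (a, b) \<otimes>\<^bsub>G\<^esub> (a', b') = (\<phi> (inv\<^bsub>B\<^esub> b) (inv\<^bsub>A\<^esub> a \<otimes>\<^bsub>A\<^esub> a'), inv\<^bsub>B\<^esub> b \<otimes>\<^bsub>B\<^esub> b')"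
  using assms by (simp add: inv_semidirect \<phi>_mult)

lemma subgroup_semidirect:
  assumes X: "subgroup X A" and Y: "subgroup Y B" and inv: "\<And>b. b \<in> Y \<Longrightarrow> \<phi> b ` X \<subseteq> X"
  shows "subgroup (X \<times> Y) G"
proof (rule group.subgroupI[OF group_semidirect])
  show "X \<times> Y \<subseteq> carrier G" using subgroup.subset[OF X] subgroup.subset[OF Y] by auto
  show "X \<times> Y \<noteq> {}" using subgroup.one_closed[OF X] subgroup.one_closed[OF Y] by blast
  show "inv\<^bsub>G\<^esub> x \<in> X \<times> Y" if "x \<in> X \<times> Y" for x
    using that inv subgroup.m_inv_closed[OF X] subgroup.m_inv_closed[OF Y]
      subgroup.mem_carrier[OF X] subgroup.mem_carrier[OF Y]
    by (cases x) (auto simp: inv_semidirect)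
  show "x \<otimes>\<^bsub>G\<^esub> y \<in> X \<times> Y" if "x \<in> X \<times> Y" "y \<in> X \<times> Y" for x y
    using that inv subgroup.m_closed[OF X] subgroup.m_closed[OF Y]
    by (cases x; cases y) auto
qed

lemma subgroup_Sub_twisting:
  assumes t: "t \<in> Types T" shows "subgroup (Sub T t) G"
  unfolding Sub_twisting[OF t]
proof (rule subgroup_semidirect)
  show "subgroup (parabolic \<alpha> (ltypes t)) A" using ltypes_subset[OF t] by (rule A.subgroup_parabolic)
  show "subgroup (parabolic \<beta> (rtypes t)) B" using rtypes_subset[OF t] by (rule B.subgroup_parabolic)
  show "\<phi> b ` parabolic \<alpha> (ltypes t) \<subseteq> parabolic \<alpha> (ltypes t)" if "b \<in> parabolic \<beta> (rtypes t)" for b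
    using that \<phi>_parabolic[OF _ ltypes_subset[OF t], of b] act_ltypes[OF t that]
    by (simp add: parabolic_def)
qed

text \<open>Multiplying from the left by \<open>(a, b)\<close> applies \<open>\<phi> b\<close> to
  the first component, which moves the types in \<open>X\<close>. The type set of the
  \<open>A\<close>-factor therefore varies with \<open>b\<close>, and the Helly property is needed
  for cosets of arbitrary parabolic subgroups.\<close>

lemma semidirect_l_coset:
  assumes "a \<in> carrier A" "b \<in> carrier B" "X \<subseteq> Types \<alpha>"
  shows "(a, b) <#\<^bsub>G\<^esub> (parabolic \<alpha> X \<times> Y) =
    (a <#\<^bsub>A\<^esub> parabolic \<alpha> (act b ` X)) \<times> (b <#\<^bsub>B\<^esub> Y)"
  unfolding \<phi>_parabolic[OF assms(2,3), symmetric] by (auto simp: l_coset_def)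

end

sublocale twisting_data \<subseteq> T: coset_incidence G T
  by (intro coset_incidence.intro coset_incidence_axioms.intro group_semidirect Grp_twisting
    subgroup_Sub_twisting)

context twisting_data
begin

section \<open>Flag-transitivity of the twisting\<close>

lemma element_twistingE:
  assumes "x \<in> elements (system_of T)"
  obtains t a b where "t \<in> Types T" "a \<in> carrier A" "b \<in> carrier B"
    "x = (t, (a <#\<^bsub>A\<^esub> parabolic \<alpha> (act b ` ltypes t)) \<times> (b <#\<^bsub>B\<^esub> parabolic \<beta> (rtypes t)))"
proof -
  obtain t g where t: "t \<in> Types T" "g \<in> carrier G" "x = (t, g <#\<^bsub>G\<^esub> Sub T t)"
    using assms T.elements_iff by auto
  then show thesis
    using that[of t "fst g" "snd g"] semidirect_l_coset[of "fst g" "snd g", OF _ _ ltypes_subset[OF t(1)]]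
    by (auto simp: Sub_twisting[OF t(1)])
qed

lemma element_twistingI:
  assumes "t \<in> Types T" "a \<in> carrier A" "b \<in> carrier B"
  shows "(t, (a <#\<^bsub>A\<^esub> parabolic \<alpha> (act b ` ltypes t)) \<times> (b <#\<^bsub>B\<^esub> parabolic \<beta> (rtypes t))) \<in> elements (system_of T)"
  unfolding T.elements_iff Sub_twisting[OF assms(1), symmetric] semidirect_l_coset[OF assms(2,3) ltypes_subset[OF assms(1)], symmetric]
  using assms by (auto simp: Sub_twisting simp del: Types_twisting)

lemma act_image_subset: "b \<in> carrier B \<Longrightarrow> X \<subseteq> Types \<alpha> \<Longrightarrow> act b ` X \<subseteq> Types \<alpha>"
  using act_closed by blast

text \<open>If two products meet, so do their first and their second factors. The Helly property
  thus applies in \<open>A\<close> and in \<open>B\<close> separately, and the two common elements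
  form a pair common to the flag.\<close>

lemma flag_transitive_twisting: "flag_transitive T"
  unfolding T.flag_transitive_iff
proof (intro allI impI)
  fix F assume F: "flag (system_of T) F"
  \<comment> \<open>A presentation as a product is to be chosen for every element of
    \<open>F\<close>; packing its data into a tuple lets one use of \<open>bchoice\<close> supply
    all four functions.\<close>
  have "\<forall>x\<in>F. \<exists>p. (case p of (a, X, b, Y) \<Rightarrow> a \<in> carrier A \<and> X \<subseteq> Types \<alpha> \<and> b \<in> carrier B \<and> Y \<subseteq> Types \<beta> \<and>
      snd x = (a <#\<^bsub>A\<^esub> parabolic \<alpha> X) \<times> (b <#\<^bsub>B\<^esub> parabolic \<beta> Y))"
  proof
    fix x assume "x \<in> F"
    then have "x \<in> elements (system_of T)" using F by (auto simp: flag_def)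
    then obtain t a b where t: "t \<in> Types T" "a \<in> carrier A" "b \<in> carrier B"
      "x = (t, (a <#\<^bsub>A\<^esub> parabolic \<alpha> (act b ` ltypes t)) \<times> (b <#\<^bsub>B\<^esub> parabolic \<beta> (rtypes t)))"
      by (rule element_twistingE)
    then show "\<exists>p. (case p of (a, X, b, Y) \<Rightarrow> a \<in> carrier A \<and> X \<subseteq> Types \<alpha> \<and> b \<in> carrier B \<and> Y \<subseteq> Types \<beta> \<and>
      snd x = (a <#\<^bsub>A\<^esub> parabolic \<alpha> X) \<times> (b <#\<^bsub>B\<^esub> parabolic \<beta> Y))"
      using act_image_subset[OF t(3) ltypes_subset[OF t(1)]] rtypes_subset[OF t(1)]
      by (intro exI[of _ "(a, act b ` ltypes t, b, rtypes t)"]) simp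
  qed
  then obtain p where p: "\<forall>x\<in>F. (case p x of (a, X, b, Y) \<Rightarrow> a \<in> carrier A \<and> X \<subseteq> Types \<alpha> \<and> b \<in> carrier B \<and> Y \<subseteq> Types \<beta> \<and>
      snd x = (a <#\<^bsub>A\<^esub> parabolic \<alpha> X) \<times> (b <#\<^bsub>B\<^esub> parabolic \<beta> Y))"
    by (rule bchoice[THEN exE])
  define a X b Y where "a x = fst (p x)" and "X x = fst (snd (p x))" and
    "b x = fst (snd (snd (p x)))" and "Y x = snd (snd (snd (p x)))" for x
  have *: "a x \<in> carrier A" "X x \<subseteq> Types \<alpha>" "b x \<in> carrier B" "Y x \<subseteq> Types \<beta>"
    "snd x = (a x <#\<^bsub>A\<^esub> parabolic \<alpha> (X x)) \<times> (b x <#\<^bsub>B\<^esub> parabolic \<beta> (Y x))" if "x \<in> F" for x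
    using p[rule_format, OF that] by (auto simp: a_def X_def b_def Y_def split: prod.splits)
  \<comment> \<open>A flag gives incidence of distinct members only; for \<open>x = y\<close> the
    coset is nonempty, as it contains its representative.\<close>
  have meet: "snd x \<inter> snd y \<noteq> {}" if "x \<in> F" "y \<in> F" for x y
  proof (cases "x = y")
    case True
    have "x \<in> elements (system_of T)" using F that by (auto simp: flag_def)
    then have "snd x \<noteq> {}" using T.self_mem_l_coset T.subgroup_Sub by (fastforce simp: T.elements_iff simp del: Types_twisting)
    then show ?thesis using True by simp
  qed (use F that in \<open>auto simp: flag_def pairwise_def\<close>)
  obtain g where g: "g \<in> carrier A" "\<And>x. x \<in> F \<Longrightarrow> g \<in> a x <#\<^bsub>A\<^esub> parabolic \<alpha> (X x)"
  proof (rule A.parabolic_cosets_Helly[of F X a])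
    show "(a x <#\<^bsub>A\<^esub> parabolic \<alpha> (X x)) \<inter> (a y <#\<^bsub>A\<^esub> parabolic \<alpha> (X y)) \<noteq> {}" if "x \<in> F" "y \<in> F" for x y
      using meet[OF that] unfolding *(5)[OF that(1)] *(5)[OF that(2)] by blast
  qed (use * in blast)+
  obtain h where h: "h \<in> carrier B" "\<And>x. x \<in> F \<Longrightarrow> h \<in> b x <#\<^bsub>B\<^esub> parabolic \<beta> (Y x)"
  proof (rule B.parabolic_cosets_Helly[of F Y b])
    show "(b x <#\<^bsub>B\<^esub> parabolic \<beta> (Y x)) \<inter> (b y <#\<^bsub>B\<^esub> parabolic \<beta> (Y y)) \<noteq> {}" if "x \<in> F" "y \<in> F" for x y
      using meet[OF that] unfolding *(5)[OF that(1)] *(5)[OF that(2)] by blast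
  qed (use * in blast)+
  have "(g, h) \<in> snd x" if "x \<in> F" for x
    unfolding *(5)[OF that] using g(2)[OF that] h(2)[OF that] by blast
  then show "\<exists>g\<in>carrier G. \<forall>x\<in>F. g \<in> snd x" using g h by (intro bexI[of _ "(g, h)"]) auto
qed

end

sublocale twisting_data \<subseteq> T: flag_transitive_coset_incidence G T
  by unfold_locales (rule flag_transitive_twisting)

context twisting_data
begin

section \<open>Finiteness of the twisting\<close>

text \<open>An element of the twisting is a type with a product of two parabolic cosets, and finite
  systems have finitely many of each. Conversely, elements of \<open>\<beta>\<close> are second
  projections, and cosets in \<open>\<alpha>\<close> are unions of first projections.\<close>

lemma finite_elements_twisting_iff:
  "finite (elements (system_of T)) \<longleftrightarrow> finite (elements (system_of \<alpha>)) \<and> finite (elements (system_of \<beta>))"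
proof (intro iffI conjI)
  assume "finite (elements (system_of \<alpha>)) \<and> finite (elements (system_of \<beta>))"
  then have fin: "finite (elements (system_of \<alpha>))" "finite (elements (system_of \<beta>))" by auto
  define \<A> where "\<A> = {g <#\<^bsub>A\<^esub> parabolic \<alpha> J | g J. g \<in> carrier A \<and> J \<subseteq> Types \<alpha>}"
  define \<B> where "\<B> = {g <#\<^bsub>B\<^esub> parabolic \<beta> J | g J. g \<in> carrier B \<and> J \<subseteq> Types \<beta>}"
  have "finite (Types T)"
    using fin A.Types_eq_fst_elements B.Types_eq_fst_elements by (auto simp: type_orbits_def)
  then have "finite (Types T \<times> (\<lambda>(P, Q). P \<times> Q) ` (\<A> \<times> \<B>))"
    using A.finite_parabolic_cosets[OF fin(1)] B.finite_parabolic_cosets[OF fin(2)]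
    by (simp add: \<A>_def \<B>_def)
  moreover have "elements (system_of T) \<subseteq> Types T \<times> (\<lambda>(P, Q). P \<times> Q) ` (\<A> \<times> \<B>)"
  proof
    fix x assume "x \<in> elements (system_of T)"
    then obtain t a b where t: "t \<in> Types T" "a \<in> carrier A" "b \<in> carrier B"
      "x = (t, (a <#\<^bsub>A\<^esub> parabolic \<alpha> (act b ` ltypes t)) \<times> (b <#\<^bsub>B\<^esub> parabolic \<beta> (rtypes t)))"
      by (rule element_twistingE)
    have "a <#\<^bsub>A\<^esub> parabolic \<alpha> (act b ` ltypes t) \<in> \<A>"
      using t(2) act_image_subset[OF t(3) ltypes_subset[OF t(1)]] unfolding \<A>_def by blast
    moreover have "b <#\<^bsub>B\<^esub> parabolic \<beta> (rtypes t) \<in> \<B>"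
      using t(3) rtypes_subset[OF t(1)] unfolding \<B>_def by blast
    ultimately show "x \<in> Types T \<times> (\<lambda>(P, Q). P \<times> Q) ` (\<A> \<times> \<B>)" using t(1,4) by auto
  qed
  ultimately show "finite (elements (system_of T))" by (rule finite_subset[rotated])
next
  assume fin: "finite (elements (system_of T))"
  have "elements (system_of \<beta>) \<subseteq> (\<lambda>(t, S). (projl t, snd ` S)) ` elements (system_of T)"
  proof
    fix x assume "x \<in> elements (system_of \<beta>)"
    then obtain i b where x: "i \<in> Types \<beta>" "b \<in> carrier B" "x = (i, b <#\<^bsub>B\<^esub> Sub \<beta> i)"
      by (auto simp: B.elements_iff)
    have t: "Inl i \<in> Types T" using x(1) by auto
    let ?P = "\<one>\<^bsub>A\<^esub> <#\<^bsub>A\<^esub> parabolic \<alpha> (act b ` ltypes (Inl i))"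
    \<comment> \<open>Only for a nonempty first factor is the second projection of the product the
      whole \<open>B\<close>-coset.\<close>
    have "?P \<noteq> {}"
      using A.self_mem_l_coset[OF A.subgroup_parabolic[OF act_image_subset[OF x(2) ltypes_subset[OF t]]] A.one_closed] by blast
    moreover have "(Inl i, ?P \<times> (b <#\<^bsub>B\<^esub> Sub \<beta> i)) \<in> elements (system_of T)"
      using element_twistingI[OF t A.one_closed x(2)] x(1) by (simp add: B.parabolic_single)
    ultimately show "x \<in> (\<lambda>(t, S). (projl t, snd ` S)) ` elements (system_of T)"
      by (intro rev_image_eqI) (auto simp: x(3))
  qed
  then show "finite (elements (system_of \<beta>))" using fin finite_surj by blast
  have "a <#\<^bsub>A\<^esub> Sub \<alpha> i \<in> (\<lambda>E. fst ` \<Union>(snd ` E)) ` Pow (elements (system_of T))"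
    if i: "i \<in> Types \<alpha>" and a: "a \<in> carrier A" for a i
  proof -
    note S = A.subgroup_Sub[OF i]
    obtain k where k: "k \<in> K" "i \<in> k" using ex_orbit[OF i] by blast
    \<comment> \<open>The element of type \<open>Inr k\<close> above \<open>y\<close> projects to a
      coset of \<open>parabolic \<alpha> k\<close>, which can be smaller than the coset of
      \<open>Sub \<alpha> i\<close>; the latter is the union of such projections.\<close>
    define E where "E = {e \<in> elements (system_of T). fst ` snd e \<subseteq> a <#\<^bsub>A\<^esub> Sub \<alpha> i}"
    have "a <#\<^bsub>A\<^esub> Sub \<alpha> i \<subseteq> fst ` \<Union>(snd ` E)"
    proof
      fix y assume y: "y \<in> a <#\<^bsub>A\<^esub> Sub \<alpha> i"
      then have yA: "y \<in> carrier A" using A.mem_l_coset_iff[OF S a] by blast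
      have "act \<one>\<^bsub>B\<^esub> ` k = k" by (rule act_one_image[OF orbit_subset[OF k(1)]])
      moreover have "\<one>\<^bsub>B\<^esub> <#\<^bsub>B\<^esub> parabolic \<beta> {} = carrier B"
        using B.lcos_mult_one[of "carrier B"] by (simp add: parabolic_def)
      ultimately have e: "(Inr k, (y <#\<^bsub>A\<^esub> parabolic \<alpha> k) \<times> carrier B) \<in> elements (system_of T)"
        using element_twistingI[of "Inr k", OF _ yA B.one_closed] k by auto
      have "y <#\<^bsub>A\<^esub> parabolic \<alpha> k \<subseteq> y <#\<^bsub>A\<^esub> Sub \<alpha> i"
        using k(2) by (auto simp: l_coset_def parabolic_def)
      also have "\<dots> = a <#\<^bsub>A\<^esub> Sub \<alpha> i" using A.l_coset_mem_eq[OF S a y] by simp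
      finally have "(Inr k, (y <#\<^bsub>A\<^esub> parabolic \<alpha> k) \<times> carrier B) \<in> E" using e by (auto simp: E_def)
      moreover have "y \<in> y <#\<^bsub>A\<^esub> parabolic \<alpha> k"
        using yA A.subgroup_parabolic[OF orbit_subset[OF k(1)]] by (rule A.self_mem_l_coset[rotated])
      ultimately show "y \<in> fst ` \<Union>(snd ` E)"
        by (intro image_eqI[of _ _ "(y, \<one>\<^bsub>B\<^esub>)"]) (auto intro!: bexI)
    qed
    moreover have "fst ` \<Union>(snd ` E) \<subseteq> a <#\<^bsub>A\<^esub> Sub \<alpha> i" by (auto simp: E_def)
    moreover have "E \<in> Pow (elements (system_of T))" by (auto simp: E_def)
    ultimately show ?thesis by blast
  qed
  then have sub: "snd ` elements (system_of \<alpha>) \<subseteq> (\<lambda>E. fst ` \<Union>(snd ` E)) ` Pow (elements (system_of T))"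
    by (auto simp: A.elements_iff)
  have fin_snd: "finite (snd ` elements (system_of \<alpha>))"
    by (rule finite_subset[OF sub]) (simp add: fin)
  \<comment> \<open>So far only the cosets without their tags are bounded. Each
    \<open>Sub \<alpha> i\<close> is itself a coset, so \<open>inj_on_Sub\<close> bounds the types
    too.\<close>
  have "Sub \<alpha> i \<in> snd ` elements (system_of \<alpha>)" if "i \<in> Types \<alpha>" for i
    using that A.lcos_mult_one[OF Sub_subset[OF that]] A.one_closed
    by (force simp: A.elements_iff)
  then have "finite (Sub \<alpha> ` Types \<alpha>)" using fin_snd by (meson finite_subset image_subsetI)
  then have "finite (Types \<alpha>)" using inj_on_Sub by (rule finite_imageD)
  moreover have "elements (system_of \<alpha>) \<subseteq> Types \<alpha> \<times> snd ` elements (system_of \<alpha>)"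
    by (force simp: A.Types_eq_fst_elements)
  ultimately show "finite (elements (system_of \<alpha>))" using fin_snd finite_subset by blast
qed

section \<open>Parabolic subgroups, firmness and thinness of the twisting\<close>

text \<open>Products are intersected factor by factor, and intersecting parabolic subgroups unites
  their type sets.\<close>

lemma parabolic_twisting:
  assumes "J \<subseteq> Types T"
  shows "parabolic T J = parabolic \<alpha> (\<Union>(ltypes ` J)) \<times> parabolic \<beta> (\<Union>(rtypes ` J))"
proof -
  have "parabolic T J = (carrier A \<times> carrier B) \<inter> (\<Inter>t\<in>J. parabolic \<alpha> (ltypes t) \<times> parabolic \<beta> (rtypes t))"
    using assms Sub_twisting unfolding parabolic_def[of T] by (intro arg_cong2[of _ _ _ _ inter] INF_cong) auto
  then show ?thesis unfolding parabolic_UN by auto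
qed

lemma ltypes_Un_subset: "J \<subseteq> Types T \<Longrightarrow> \<Union>(ltypes ` J) \<subseteq> Types \<alpha>"
  using ltypes_subset by blast

lemma rtypes_Un_subset: "J \<subseteq> Types T \<Longrightarrow> \<Union>(rtypes ` J) \<subseteq> Types \<beta>"
  using rtypes_subset by blast

text \<open>When \<open>Inr k\<close> is left out, no remaining type of the twisting covers
  \<open>l\<close>: other orbits are disjoint from \<open>k\<close>, and the sets
  \<open>L - orb i\<close> omit \<open>F0\<close>.\<close>

lemma ex_missing_type:
  assumes k: "k \<in> K"
  shows "\<exists>l\<in>k. \<Union>(ltypes ` (Types T - {Inr k})) \<subseteq> Types \<alpha> - {l} \<and> (k \<noteq> L \<longrightarrow> k = {l}) \<and> (k = L \<longrightarrow> l = F0)"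
proof -
  obtain l where l: "l \<in> k" "k \<noteq> L \<longrightarrow> k = {l}" "k = L \<longrightarrow> l = F0"
    using orbit_ne[OF k] orbit_singleton[OF k] F0_in_L by (cases "k = L") auto
  have "l \<notin> ltypes t" if t: "t \<in> Types T" "t \<noteq> Inr k" for t
  proof
    assume m: "l \<in> ltypes t"
    show False
    proof (cases t)
      case (Inl i)
      then have "l \<in> L" "l \<notin> orb i" using m by auto
      then show False using l orbits_disjoint[OF k L_in_K l(1)] F0_orb[of i] t Inl by auto
    next
      case (Inr k')
      then show False using m t orbits_disjoint[of k' k l] k l by auto
    qed
  qed
  then show ?thesis using l ltypes_Un_subset[of "Types T - {Inr k}"] by blast
qed

text \<open>The witness lives in one factor: for \<open>Inl i\<close> it comes from firmness of
  \<open>\<beta>\<close> at \<open>i\<close>, for \<open>Inr k\<close> from firmness of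
  \<open>\<alpha>\<close> at the uncovered type \<open>l\<close>, with the identity as other
  component.\<close>

lemma firm_twisting:
  assumes "firm (system_of \<alpha>)" "firm (system_of \<beta>)" shows "firm (system_of T)"
  unfolding T.firm_iff
proof
  fix t assume t: "t \<in> Types T"
  have sub: "Types T - {t} \<subseteq> Types T" by blast
  show "\<not> parabolic T (Types T - {t}) \<subseteq> Sub T t"
  proof (cases t)
    case (Inl i)
    then have i: "i \<in> Types \<beta>" using t by auto
    then obtain b where b: "b \<in> parabolic \<beta> (Types \<beta> - {i})" "b \<notin> Sub \<beta> i"
      using assms(2) B.firm_iff by blast
    have "\<Union>(rtypes ` (Types T - {t})) \<subseteq> Types \<beta> - {i}" using Inl by auto
    from subsetD[OF parabolic_antimono[OF this] b(1)]
    have "(\<one>\<^bsub>A\<^esub>, b) \<in> parabolic T (Types T - {t})"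
      unfolding parabolic_twisting[OF sub] by (intro SigmaI A.one_mem_parabolic ltypes_Un_subset sub)
    moreover have "(\<one>\<^bsub>A\<^esub>, b) \<notin> Sub T t"
      unfolding Sub_twisting[OF t] using b i Inl by (simp add: B.parabolic_single)
    ultimately show ?thesis by blast
  next
    case (Inr k)
    then have k: "k \<in> K" using t by auto
    obtain l where l: "l \<in> k" "\<Union>(ltypes ` (Types T - {t})) \<subseteq> Types \<alpha> - {l}"
      using ex_missing_type[OF k] Inr by blast
    then have "l \<in> Types \<alpha>" using orbit_subset[OF k] by blast
    then obtain a where a: "a \<in> parabolic \<alpha> (Types \<alpha> - {l})" "a \<notin> Sub \<alpha> l"
      using assms(1) A.firm_iff by blast
    from subsetD[OF parabolic_antimono[OF l(2)] a(1)]
    have "(a, \<one>\<^bsub>B\<^esub>) \<in> parabolic T (Types T - {t})"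
      unfolding parabolic_twisting[OF sub] by (intro SigmaI B.one_mem_parabolic rtypes_Un_subset sub)
    moreover have "(a, \<one>\<^bsub>B\<^esub>) \<notin> Sub T t"
      unfolding Sub_twisting[OF t] using a l Inr by (auto simp: parabolic_def)
    ultimately show ?thesis by blast
  qed
qed

text \<open>Within the parabolic subgroup of the other types, membership in \<open>Sub T t\<close>
  depends on one component only, and thinness of that factor decides. The assumption
  \<open>F0\<close> says that \<open>parabolic \<beta> (Types \<beta>)\<close> fixes the base point,
  so that the sets \<open>L - orb i\<close> cover all of \<open>L\<close> except it.\<close>

lemma thin_twisting:
  assumes fin: "finite (Types \<beta>)" and F0: "parabolic_orbit \<alpha> \<beta> \<phi> F0 {} = {F0}"
    and thin: "thin (system_of \<alpha>)" "thin (system_of \<beta>)"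
  shows "thin (system_of T)"
  unfolding T.thin_iff
proof (intro ballI conjI)
  fix t assume t: "t \<in> Types T"
  show "\<not> parabolic T (Types T - {t}) \<subseteq> Sub T t"
    using firm_twisting[OF thin[THEN thin_imp_firm]] t unfolding T.firm_iff by blast
next
  fix t g h assume t: "t \<in> Types T"
    and gh: "g \<in> parabolic T (Types T - {t}) - Sub T t" "h \<in> parabolic T (Types T - {t}) - Sub T t"
  have sub: "Types T - {t} \<subseteq> Types T" by blast
  define P where "P = parabolic \<alpha> (\<Union>(ltypes ` (Types T - {t})))"
  define Q where "Q = parabolic \<beta> (\<Union>(rtypes ` (Types T - {t})))"
  have PQ: "parabolic T (Types T - {t}) = P \<times> Q" using parabolic_twisting[OF sub] by (simp add: P_def Q_def)
  obtain a b a' b' where g: "g = (a, b)" and h: "h = (a', b')" by (metis surj_pair)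
  have ab: "a \<in> P" "a' \<in> P" "b \<in> Q" "b' \<in> Q" using gh PQ g h by auto
  have carr: "a \<in> carrier A" "a' \<in> carrier A" "b \<in> carrier B" "b' \<in> carrier B"
    using ab by (auto simp: P_def Q_def parabolic_def)
  have mem: "inv\<^bsub>G\<^esub> g \<otimes>\<^bsub>G\<^esub> h \<in> P \<times> Q"
    using gh T.subgroup_parabolic[OF sub] unfolding PQ by (blast intro: subgroup.m_closed subgroup.m_inv_closed)
  have eq: "inv\<^bsub>G\<^esub> g \<otimes>\<^bsub>G\<^esub> h = (\<phi> (inv\<^bsub>B\<^esub> b) (inv\<^bsub>A\<^esub> a \<otimes>\<^bsub>A\<^esub> a'), inv\<^bsub>B\<^esub> b \<otimes>\<^bsub>B\<^esub> b')"
    unfolding g h using carr by (intro inv_mult_semidirect)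
  show "inv\<^bsub>G\<^esub> g \<otimes>\<^bsub>G\<^esub> h \<in> Sub T t"
  proof (cases t)
    case (Inl i)
    then have i: "i \<in> Types \<beta>" using t by auto
    \<comment> \<open>\<open>Inr L\<close> is among the remaining types and covers
      \<open>L - orb i\<close>. The \<open>A\<close>-components thus satisfy their condition
      automatically.\<close>
    have "ltypes t \<subseteq> \<Union>(ltypes ` (Types T - {t}))"
      using L_in_K Inl by force
    then have P: "P \<subseteq> parabolic \<alpha> (ltypes t)" unfolding P_def by (rule parabolic_antimono)
    then have "b \<notin> Sub \<beta> i" "b' \<notin> Sub \<beta> i"
      using gh ab g h i Inl unfolding Sub_twisting[OF t] by (auto simp: B.parabolic_single)
    moreover have "Types \<beta> - {i} \<subseteq> \<Union>(rtypes ` (Types T - {t}))"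
      using Inl by force
    then have "Q \<subseteq> parabolic \<beta> (Types \<beta> - {i})" unfolding Q_def by (rule parabolic_antimono)
    ultimately have "inv\<^bsub>B\<^esub> b \<otimes>\<^bsub>B\<^esub> b' \<in> Sub \<beta> i"
      using thin(2) i ab B.thin_iff by blast
    then show ?thesis
      using mem P i Inl unfolding eq Sub_twisting[OF t] by (auto simp: B.parabolic_single)
  next
    case (Inr k)
    then have k: "k \<in> K" using t by auto
    obtain l where l: "l \<in> k" "k \<noteq> L \<longrightarrow> k = {l}" "k = L \<longrightarrow> l = F0"
      using ex_missing_type[OF k] by blast
    have lT: "l \<in> Types \<alpha>" using l orbit_subset[OF k] by blast
    \<comment> \<open>This is the reverse of the inclusion in \<open>ex_missing_type\<close>:
      nothing but \<open>l\<close> is left uncovered.\<close>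
    have "Types \<alpha> - {l} \<subseteq> \<Union>(ltypes ` (Types T - {t}))"
    proof
      fix x assume x: "x \<in> Types \<alpha> - {l}"
      then obtain k' where k': "k' \<in> K" "x \<in> k'" using ex_orbit by blast
      show "x \<in> \<Union>(ltypes ` (Types T - {t}))"
      proof (cases "k' = k")
        case True
        then have "k = L" "x \<noteq> F0" "x \<in> L" using x l k' by auto
        \<comment> \<open>By \<open>mem_parabolic_type_orbit\<close>, a type of \<open>L\<close>
          outside the orbit under the intersection of all \<open>Sub \<beta> i\<close> is already
          missed by a single \<open>orb i\<close>.\<close>
        then have "x \<notin> type_orbit \<alpha> \<phi> (parabolic \<beta> (Types \<beta>)) F0"
          using F0 by (simp add: parabolic_orbit_def)
        then obtain i where "i \<in> Types \<beta>" "x \<notin> orb i"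
          using mem_parabolic_type_orbit[OF fin subset_refl \<open>x \<in> L\<close>] by blast
        then show ?thesis using \<open>x \<in> L\<close> Inr by (intro UN_I[of "Inl i"]) auto
      next
        case False
        then show ?thesis using k' Inr by (intro UN_I[of "Inr k'"]) auto
      qed
    qed
    then have P: "P \<subseteq> parabolic \<alpha> (Types \<alpha> - {l})" unfolding P_def by (rule parabolic_antimono)
    have Pk: "x \<in> parabolic \<alpha> k" if "x \<in> parabolic \<alpha> (Types \<alpha> - {l})" "x \<in> Sub \<alpha> l" for x
      using that orbit_subset[OF k] by (auto simp: parabolic_def)
    have "a \<notin> parabolic \<alpha> k" "a' \<notin> parabolic \<alpha> k"
      using gh carr g h Inr unfolding Sub_twisting[OF t] by (simp_all add: parabolic_def[of \<beta>])
    then have "a \<notin> Sub \<alpha> l" "a' \<notin> Sub \<alpha> l" using ab P Pk by blast+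
    then have "inv\<^bsub>A\<^esub> a \<otimes>\<^bsub>A\<^esub> a' \<in> Sub \<alpha> l" using thin(1) lT ab P A.thin_iff by blast
    moreover have "inv\<^bsub>A\<^esub> a \<otimes>\<^bsub>A\<^esub> a' \<in> parabolic \<alpha> (Types \<alpha> - {l})"
      using ab P A.subgroup_parabolic[of "Types \<alpha> - {l}"] by (blast intro: subgroup.m_closed subgroup.m_inv_closed)
    ultimately have "inv\<^bsub>A\<^esub> a \<otimes>\<^bsub>A\<^esub> a' \<in> parabolic \<alpha> k" using Pk by blast
    \<comment> \<open>The \<open>A\<close>-component of the quotient is twisted by
      \<open>\<phi>\<close> of the inverse of \<open>b\<close>; this is harmless because
      \<open>k\<close> is invariant under \<open>B\<close>.\<close>
    moreover have "act (inv\<^bsub>B\<^esub> b) ` k = k"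
      using act_ltypes[OF t, of "inv\<^bsub>B\<^esub> b"] Inr carr by (simp add: parabolic_def)
    ultimately have "\<phi> (inv\<^bsub>B\<^esub> b) (inv\<^bsub>A\<^esub> a \<otimes>\<^bsub>A\<^esub> a') \<in> parabolic \<alpha> k"
      using \<phi>_parabolic[OF B.inv_closed[OF carr(3)] orbit_subset[OF k]] by (metis imageI)
    then show ?thesis using Inr carr unfolding eq Sub_twisting[OF t] by (simp add: parabolic_def[of \<beta>])
  qed
qed

section \<open>Residual connectedness of the twisting\<close>

text \<open>The combinatorial core of residual connectedness. The translates by \<open>b\<close> are
  essential: a type of \<open>L\<close> can lie in every untranslated set, but one outside the union
  for \<open>J\<close> can be moved back to \<open>F0\<close>, which lies in no
  \<open>L - orb j\<close>.\<close>

lemma Inter_ltypes_subset: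
  assumes J: "J \<subseteq> Types T" and fin: "finite (Types \<beta>)"
    and s: "s \<in> Types T - J" "s' \<in> Types T - J" "s \<noteq> s'"
  shows "(\<Inter>t\<in>Types T - J. \<Inter>b\<in>parabolic \<beta> (\<Union>(rtypes ` J)). act b ` \<Union>(ltypes ` insert t J))
    \<subseteq> \<Union>(ltypes ` J)"
proof
  let ?S = "\<Union>(ltypes ` J)" and ?M = "\<Union>(rtypes ` J)"
  fix x assume x: "x \<in> (\<Inter>t\<in>Types T - J. \<Inter>b\<in>parabolic \<beta> ?M. act b ` \<Union>(ltypes ` insert t J))"
  have ST: "\<Union>(ltypes ` insert t J) \<subseteq> Types \<alpha>" if "t \<in> Types T" for t
    using that J by (intro ltypes_Un_subset) auto
  have M: "?M \<subseteq> Types \<beta>" by (rule rtypes_Un_subset[OF J])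
  show "x \<in> ?S"
  proof (rule ccontr)
    assume nx: "x \<notin> ?S"
    have xt: "x \<in> ltypes t" if t: "t \<in> Types T - J" for t
    proof -
      have "x \<in> act \<one>\<^bsub>B\<^esub> ` \<Union>(ltypes ` insert t J)" using x t B.one_mem_parabolic[OF M] by blast
      also have "\<dots> = \<Union>(ltypes ` insert t J)" using ST t by (intro act_one_image) blast
      finally show ?thesis using nx by auto
    qed
    show False
    proof (cases "x \<in> L")
      case False
      \<comment> \<open>Outside \<open>L\<close>, only the orbit of \<open>x\<close> can contain
        \<open>x\<close>. This leaves one candidate for \<open>t\<close>, against
        \<open>s \<noteq> s'\<close>.\<close>
      have "t = Inr (type_orbit \<alpha> \<phi> (carrier B) x)" if "t \<in> Types T - J" for t
        using xt[OF that] False orbit_eq(2) that by (cases t) auto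
      then show False using s by metis
    next
      case True
      obtain t where t: "t \<in> Types T - J" "t \<noteq> Inr L" using s by metis
      obtain i where i: "t = Inl i"
        using xt[OF t(1)] t True orbits_disjoint[OF _ L_in_K] by (cases t) auto
      then have iT: "i \<in> Types \<beta>" using t by auto
      \<comment> \<open>\<open>Inl j\<close> belongs to \<open>J\<close>, so \<open>x\<close> avoids
        \<open>L - orb j\<close> only by lying in \<open>orb j\<close>. Condition (3) then makes
        \<open>x\<close> a translate of \<open>F0\<close> under the parabolic subgroup of type
        \<open>?M\<close>.\<close>
      have "x \<in> orb j" if "j \<in> ?M" for j
      proof -
        have "Inl j \<in> J" using that by (auto simp: mem_rtypes_iff)
        then show ?thesis using nx True by auto
      qed
      then obtain b where b: "b \<in> parabolic \<beta> ?M" "x = act b F0"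
        using mem_parabolic_type_orbit[OF finite_subset[OF M fin] M True]
          type_orbit_eq[OF B.parabolic_subset_carrier F0_type] by blast
      then have "act b F0 \<in> act b ` \<Union>(ltypes ` insert t J)" using x t by blast
      then obtain y where y: "act b F0 = act b y" "y \<in> \<Union>(ltypes ` insert t J)" by (rule imageE)
      have "y \<in> Types \<alpha>" using y(2) ST[of t] t by blast
      moreover have "b \<in> carrier B" using b(1) B.parabolic_subset_carrier by blast
      ultimately have "F0 = y" using act_inj F0_type y(1) by blast
      then obtain r where r: "r \<in> insert t J" "F0 \<in> ltypes r" using y by blast
      \<comment> \<open>As \<open>F0\<close> is in no \<open>L - orb j\<close>, it could only come
        from \<open>Inr L\<close> in \<open>J\<close>, but then \<open>x\<close> would lie in the
        union as well.\<close>
      show False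
      proof (cases r)
        case (Inl j)
        then have "j \<in> Types \<beta>" using r t J by auto
        then show False using F0_orb r Inl by auto
      next
        case (Inr k)
        then have "r \<in> J" using r i by auto
        moreover have "k = L" using orbits_disjoint[OF _ L_in_K _ F0_in_L] J Inr r \<open>r \<in> J\<close> by auto
        ultimately show False using nx True Inr by force
      qed
    qed
  qed
qed

text \<open>The slices \<open>HA\<close> and \<open>HB\<close> of \<open>H\<close> are subgroups of
  the factors. The \<open>B\<close>-part of \<open>parabolic T J\<close> is placed in
  \<open>HB\<close> first; conjugation by it then supplies the translated parabolic subgroups which
  \<open>Inter_ltypes_subset\<close> needs for the \<open>A\<close>-part.\<close>

lemma residually_connected_twisting:
  assumes fin: "finite (Types \<alpha>)" "finite (Types \<beta>)"
    and rc: "residually_connected (system_of \<alpha>)" "residually_connected (system_of \<beta>)"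
  shows "residually_connected (system_of T)"
  unfolding T.residually_connected_iff
proof (intro allI impI, elim conjE)
  fix J H assume J: "J \<subseteq> Types T" and two: "infinite (Types T - J) \<or> 2 \<le> card (Types T - J)"
    and H: "subgroup H G" and gen: "\<forall>t\<in>Types T - J. parabolic T (insert t J) \<subseteq> H"
  let ?S = "\<lambda>J. \<Union>(ltypes ` J)" and ?M = "\<lambda>J. \<Union>(rtypes ` J)"
  have "finite (Types T)" using fin by (simp add: type_orbits_def)
  then have "2 \<le> card (Types T - J)" using two by auto
  then obtain s s' where s: "s \<in> Types T - J" "s' \<in> Types T - J" "s \<noteq> s'"
    by (metis card_le_Suc0_iff_eq card.infinite not_less_eq_eq numeral_2_eq_2 zero_le)
  have sub: "insert t J \<subseteq> Types T" if "t \<in> Types T - J" for t using that J by blast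
  have par: "parabolic \<alpha> (?S (insert t J)) \<times> parabolic \<beta> (?M (insert t J)) \<subseteq> H" if "t \<in> Types T - J" for t
    using gen that parabolic_twisting[OF sub[OF that]] by blast
  define HA where "HA = {a \<in> carrier A. (a, \<one>\<^bsub>B\<^esub>) \<in> H}"
  define HB where "HB = {b \<in> carrier B. (\<one>\<^bsub>A\<^esub>, b) \<in> H}"
  have "subgroup HA A"
  proof (rule A.subgroupI)
    show "HA \<noteq> {}" using subgroup.one_closed[OF H] by (auto simp: HA_def)
    show "inv\<^bsub>A\<^esub> a \<in> HA" if "a \<in> HA" for a
      using that subgroup.m_inv_closed[OF H, of "(a, \<one>\<^bsub>B\<^esub>)"] by (auto simp: HA_def inv_semidirect)
    show "a \<otimes>\<^bsub>A\<^esub> a' \<in> HA" if "a \<in> HA" "a' \<in> HA" for a a'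
      using that subgroup.m_closed[OF H, of "(a, \<one>\<^bsub>B\<^esub>)" "(a', \<one>\<^bsub>B\<^esub>)"] by (auto simp: HA_def)
  qed (auto simp: HA_def)
  have "subgroup HB B"
  proof (rule B.subgroupI)
    show "HB \<noteq> {}" using subgroup.one_closed[OF H] by (auto simp: HB_def)
    show "inv\<^bsub>B\<^esub> b \<in> HB" if "b \<in> HB" for b
      using that subgroup.m_inv_closed[OF H, of "(\<one>\<^bsub>A\<^esub>, b)"] by (auto simp: HB_def inv_semidirect)
    show "b \<otimes>\<^bsub>B\<^esub> b' \<in> HB" if "b \<in> HB" "b' \<in> HB" for b b'
      using that subgroup.m_closed[OF H, of "(\<one>\<^bsub>A\<^esub>, b)" "(\<one>\<^bsub>A\<^esub>, b')"] by (auto simp: HB_def)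
  qed (auto simp: HB_def)
  have parA: "parabolic \<alpha> (?S (insert t J)) \<subseteq> HA" if "t \<in> Types T - J" for t
    using par[OF that] B.one_mem_parabolic[OF rtypes_Un_subset[OF sub[OF that]]] A.parabolic_subset_carrier
    by (auto simp: HA_def)
  have parB: "parabolic \<beta> (?M (insert t J)) \<subseteq> HB" if "t \<in> Types T - J" for t
    using par[OF that] A.one_mem_parabolic[OF ltypes_Un_subset[OF sub[OF that]]] B.parabolic_subset_carrier
    by (auto simp: HB_def)
  \<comment> \<open>A missing type \<open>Inr k\<close> adds nothing to \<open>?M J\<close>, so the
    claim is immediate if there is one. Otherwise the missing types are all of the form
    \<open>Inl i\<close>, and two of them give corank at least two in
    \<open>\<beta>\<close>.\<close>
  have B_part: "parabolic \<beta> (?M J) \<subseteq> HB"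
  proof (cases "\<exists>k. Inr k \<in> Types T - J")
    case True
    then show ?thesis using parB by fastforce
  next
    case False
    have M: "?M J \<subseteq> Types \<beta>" by (rule rtypes_Un_subset[OF J])
    have Inl: "\<exists>i. t = Inl i \<and> i \<in> Types \<beta> - ?M J" if "t \<in> Types T - J" for t
    proof (cases t)
      case (Inl i)
      then show ?thesis using that by (auto simp: mem_rtypes_iff)
    qed (use that False in blast)
    then obtain i i' where "i \<in> Types \<beta> - ?M J" "i' \<in> Types \<beta> - ?M J" "i \<noteq> i'"
      using s by metis
    then have "{i, i'} \<subseteq> Types \<beta> - ?M J" "card {i, i'} = 2" by auto
    then have "2 \<le> card (Types \<beta> - ?M J)" using fin(2) by (metis card_mono finite_Diff)
    moreover have "parabolic \<beta> (insert i (?M J)) \<subseteq> HB" if "i \<in> Types \<beta> - ?M J" for i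
    proof -
      have "Inl i \<in> Types T - J" using that by force
      then show ?thesis using parB by fastforce
    qed
    ultimately show ?thesis
      using rc(2)[unfolded B.residually_connected_iff, rule_format, of "?M J" HB] M \<open>subgroup HB B\<close> by auto
  qed
  \<comment> \<open>Conjugation by an element of the \<open>B\<close>-factor acts on the
    \<open>A\<close>-factor as \<open>\<phi> b\<close>.\<close>
  have conj: "\<phi> b a \<in> HA" if "a \<in> HA" "b \<in> HB" for a b
  proof -
    have "(\<one>\<^bsub>A\<^esub>, b) \<otimes>\<^bsub>G\<^esub> (a, \<one>\<^bsub>B\<^esub>) \<otimes>\<^bsub>G\<^esub> inv\<^bsub>G\<^esub> (\<one>\<^bsub>A\<^esub>, b) \<in> H"
      using that H by (auto simp: HA_def HB_def simp del: semidirect_simps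
        intro!: subgroup.m_closed subgroup.m_inv_closed)
    then show ?thesis using that by (simp add: HA_def HB_def inv_semidirect)
  qed
  let ?\<X> = "{act b ` ?S (insert t J) | b t. b \<in> parabolic \<beta> (?M J) \<and> t \<in> Types T - J}"
  have Inter_HA: "parabolic \<alpha> (\<Inter>?\<X>) \<subseteq> HA"
  proof (rule A.parabolic_Inter_subset[OF rc(1) fin(1) \<open>subgroup HA A\<close>])
    show "?\<X> \<noteq> {}" using s B.one_mem_parabolic[OF rtypes_Un_subset[OF J]] by blast
    fix X assume "X \<in> ?\<X>"
    then obtain b t where X: "X = act b ` ?S (insert t J)" "b \<in> parabolic \<beta> (?M J)" "t \<in> Types T - J" by blast
    have b: "b \<in> carrier B" using X(2) by (simp add: parabolic_def)
    note S = ltypes_Un_subset[OF sub[OF X(3)]]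
    show "X \<subseteq> Types \<alpha>" using act_image_subset[OF b S] X(1) by simp
    have "\<phi> b ` parabolic \<alpha> (?S (insert t J)) \<subseteq> HA" using conj parA[OF X(3)] B_part X(2) by blast
    then show "parabolic \<alpha> X \<subseteq> HA" using \<phi>_parabolic[OF b S] X(1) by simp
  qed
  have Inter_S: "\<Inter>?\<X> \<subseteq> ?S J"
    by (rule order_trans[OF _ Inter_ltypes_subset[OF J fin(2) s]], intro INT_greatest Inter_lower) blast
  note A_part = order_trans[OF parabolic_antimono[OF Inter_S] Inter_HA]
  show "parabolic T J \<subseteq> H"
  proof
    fix x assume "x \<in> parabolic T J"
    then obtain a b where x: "x = (a, b)" "a \<in> HA" "b \<in> HB"
      unfolding parabolic_twisting[OF J] using A_part B_part by blast
    then have "(a, \<one>\<^bsub>B\<^esub>) \<otimes>\<^bsub>G\<^esub> (\<one>\<^bsub>A\<^esub>, b) \<in> H"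
      by (intro subgroup.m_closed[OF H]) (simp_all add: HA_def HB_def)
    then show "x \<in> H" using x by (simp add: HA_def HB_def)
  qed
qed

end

text \<open>Finiteness of the type sets serves the inductions in \<open>parabolic_Int_subset\<close>
  and \<open>mem_parabolic_type_orbit\<close>. The condition on \<open>F0\<close> in the thin clause
  leaves \<open>F0\<close> as the only type of \<open>L\<close> not covered by the sets
  \<open>L - orb i\<close>.\<close>

theorem theorem4p12:
  fixes \<alpha> :: "('a, 'i) coset_system" and \<beta> :: "('b, 'j) coset_system"
    and \<phi> :: "'b \<Rightarrow> 'a \<Rightarrow> 'a" and L :: "'i set" and F0 :: 'i
  assumes "coset_incidence_system \<alpha>" and "coset_incidence_system \<beta>"
    and "\<phi> \<in> hom (Grp \<beta>) (AutoGroup (Grp \<alpha>))"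
    and "admissible \<alpha> \<beta> \<phi> L F0"
    and "flag_transitive \<alpha>" and "flag_transitive \<beta>"
  shows
    "flag_transitive (twisting \<alpha> \<beta> \<phi> L F0) \<and>
     coset_geometry (twisting \<alpha> \<beta> \<phi> L F0) \<and>
     (finite_coset_geometry (twisting \<alpha> \<beta> \<phi> L F0) \<longleftrightarrow>
        finite_coset_geometry \<alpha> \<and> finite_coset_geometry \<beta>) \<and>
     (finite (Types \<alpha>) \<and> finite (Types \<beta>) \<and>
        residually_connected (system_of \<alpha>) \<and> residually_connected (system_of \<beta>) \<longrightarrow>
        residually_connected (system_of (twisting \<alpha> \<beta> \<phi> L F0))) \<and>
     (firm (system_of \<alpha>) \<and> firm (system_of \<beta>) \<longrightarrow>
        firm (system_of (twisting \<alpha> \<beta> \<phi> L F0))) \<and>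
     (finite (Types \<beta>) \<and> parabolic_orbit \<alpha> \<beta> \<phi> F0 {} = {F0} \<and>
        thin (system_of \<alpha>) \<and> thin (system_of \<beta>) \<longrightarrow>
        thin (system_of (twisting \<alpha> \<beta> \<phi> L F0)))"
proof -
  interpret twisting_data "Grp \<alpha>" \<alpha> "Grp \<beta>" \<beta> \<phi> L F0
    using assms by (simp add: twisting_data_def twisting_data_axioms_def
      flag_transitive_coset_incidence_def flag_transitive_coset_incidence_axioms_def
      coset_incidence_def coset_incidence_axioms_def coset_incidence_system_def)
  have "finite_coset_geometry T \<longleftrightarrow> finite_coset_geometry \<alpha> \<and> finite_coset_geometry \<beta>"
    by (simp add: finite_coset_geometry_def T.coset_geometry A.coset_geometry B.coset_geometry
      T.finite_system_iff A.finite_system_iff B.finite_system_iff finite_elements_twisting_iff)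
  then show ?thesis
    using flag_transitive_twisting T.coset_geometry residually_connected_twisting firm_twisting
      thin_twisting by blast
qed

end
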